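(* For all $k\in\mathbb{N}$ and $\epsilon,\delta>0$, there exists a $C>0$ such that the Newman-Watts small world network $H_{n,k,\delta}$ asymptotically almost surely (i.e., with probability tending to $1$ as $n\to\infty$) satisfies \[\bar t_{\mathrm{mix}}(H_{n,k,\delta},\epsilon)\leq C\log n.\]
   Context: The Newman-Watts small world network $H_{n,k,\delta}$ is the following random simple graph: start with $n$ vertices ordered as $v_1,\ldots,v_n$, add all edges $v_iv_j$ for which $i+1\leq j\leq i+k$ (with addition of indices modulo $n$), and then add each remaining edge (pair of distinct vertices) independently with probability $p=\delta/n$. The lazy random walk on a connected graph $H$ has transition matrix $P_H$ given by $P_H(i,i)=1/2$ and, for $i\neq j$, $P_H(i,j)=1/(2\deg_H(i))$ if $ij\in E(H)$ and $P_H(i,j)=0$ otherwise. Its stationary distribution is $\pi_H(u)=\deg_H(u)/(2|E(H)|)$. For $u\in V(H)$, $\mu_0^u$ is the point mass at $u$. Total variation distance is $d_{\mathrm{TV}}(\mu,\nu)=\frac12\sum_{v}|\mu(v)-\nu(v)|$. The average $\epsilon$-mixing time of a connected graph $H$ is \[\bar t_{\mathrm{mix}}(H,\epsilon)=\min\Big\{t\in\mathbb{N}_0:\frac{1}{|V(H)|}\sum_{u\in V(H)}d_{\mathrm{TV}}(\mu_0^uP_H^t,\pi_H)\leq\epsilon\Big\}.\] *)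

theory Defs
  imports "HOL-Probability.Probability"
begin

text \<open>
  A simple graph is a pair \<open>(V, E)\<close> where \<open>E\<close> is a set of two-element subsets of \<open>V\<close>.
\<close>

type_synonym 'a sgraph = "'a set \<times> 'a set set"

abbreviation verts :: "'a sgraph \<Rightarrow> 'a set" where "verts \<equiv> fst"

abbreviation edges :: "'a sgraph \<Rightarrow> 'a set set" where "edges \<equiv> snd"

definition degree :: "'a sgraph \<Rightarrow> 'a \<Rightarrow> nat" where
  "degree H v = card {e \<in> edges H. v \<in> e}"

definition connected_graph :: "'a sgraph \<Rightarrow> bool" where
  "connected_graph H \<longleftrightarrow>
     verts H \<noteq> {} \<and> (\<forall>u\<in>verts H. \<forall>v\<in>verts H. (u, v) \<in> {(x, y). {x, y} \<in> edges H}\<^sup>*)"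

definition lazy_walk :: "'a sgraph \<Rightarrow> 'a \<Rightarrow> 'a \<Rightarrow> real" where
  "lazy_walk H i j =
     (if i = j then 1 / 2
      else if {i, j} \<in> edges H then 1 / (2 * real (degree H i))
      else 0)"

definition stationary :: "'a sgraph \<Rightarrow> 'a \<Rightarrow> real" where
  "stationary H u = real (degree H u) / (2 * real (card (edges H)))"

text \<open>
  The row vector \<open>\<mu> P\<close>, where \<open>\<mu>\<close> and the transition matrix \<open>P\<close> are functions whose values
  matter on \<open>verts H\<close> only.
\<close>

definition walk_step :: "'a sgraph \<Rightarrow> ('a \<Rightarrow> real) \<Rightarrow> ('a \<Rightarrow> real)" where
  "walk_step H \<mu> = (\<lambda>j. \<Sum>i\<in>verts H. \<mu> i * lazy_walk H i j)"

definition walk_dist :: "'a sgraph \<Rightarrow> 'a \<Rightarrow> nat \<Rightarrow> ('a \<Rightarrow> real)" where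
  "walk_dist H u t = (walk_step H ^^ t) (indicator {u})"

definition tv_dist :: "'a set \<Rightarrow> ('a \<Rightarrow> real) \<Rightarrow> ('a \<Rightarrow> real) \<Rightarrow> real" where
  "tv_dist V \<mu> \<nu> = (1 / 2) * (\<Sum>v\<in>V. \<bar>\<mu> v - \<nu> v\<bar>)"

text \<open>
  Intended for connected graphs. The infimum in \<^typ>\<open>enat\<close> is the minimum whenever the set
  is nonempty, and \<open>\<infinity>\<close> otherwise.
\<close>

definition avg_mixing_time :: "'a sgraph \<Rightarrow> real \<Rightarrow> enat" where
  "avg_mixing_time H \<epsilon> =
     (INF t \<in> {t. (1 / real (card (verts H))) *
                   (\<Sum>u\<in>verts H. tv_dist (verts H) (walk_dist H u t) (stationary H)) \<le> \<epsilon>}.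
        enat t)"

text \<open>The vertices \<open>v\<^sub>1, \<dots>, v\<^sub>n\<close> are represented by \<open>0, \<dots>, n - 1\<close>.\<close>

definition vertex_pairs :: "nat \<Rightarrow> nat set set" where
  "vertex_pairs n = {e. e \<subseteq> {..<n} \<and> card e = 2}"

text \<open>
  The intersection with \<^const>\<open>vertex_pairs\<close> discards the loops that would occur if \<open>n \<le> k\<close>.
\<close>

definition ring_edges :: "nat \<Rightarrow> nat \<Rightarrow> nat set set" where
  "ring_edges n k = {{i, (i + d) mod n} | i d. i < n \<and> 1 \<le> d \<and> d \<le> k} \<inter> vertex_pairs n"

text \<open>
  \<^const>\<open>bernoulli_pmf\<close> truncates its parameter to the unit interval, so for the finitely many
  \<open>n < \<delta>\<close> every remaining edge is added.
\<close>

definition newman_watts :: "nat \<Rightarrow> nat \<Rightarrow> real \<Rightarrow> nat sgraph pmf" where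
  "newman_watts n k \<delta> =
     map_pmf (\<lambda>X. ({..<n}, ring_edges n k \<union> {e. X e}))
       (Pi_pmf (vertex_pairs n - ring_edges n k) False (\<lambda>_. bernoulli_pmf (\<delta> / real n)))"

lemma connected_newman_watts:
  assumes "n \<ge> 2" "k \<ge> 1" "H \<in> set_pmf (newman_watts n k \<delta>)"
  shows "connected_graph H"
proof -
  have V: "verts H = {..<n}" and E: "ring_edges n k \<subseteq> edges H"
    using assms(3) by (auto simp: newman_watts_def)
  define R where "R = {(x, y). {x, y} \<in> edges H}"
  have "sym R"
    by (auto simp: R_def sym_def insert_commute)
  have edge: "(i, Suc i) \<in> R" if "Suc i < n" for i
  proof -
    have "{i, Suc i} = {i, (i + 1) mod n}"
      using that by simp
    moreover have "{i, Suc i} \<in> vertex_pairs n"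
      using that by (auto simp: vertex_pairs_def)
    ultimately have "{i, Suc i} \<in> ring_edges n k"
      unfolding ring_edges_def using that assms(2) Suc_lessD by blast
    then show ?thesis
      using E by (auto simp: R_def)
  qed
  have *: "(0, i) \<in> R\<^sup>*" if "i < n" for i
    using that by (induction i) (auto intro: rtrancl.rtrancl_into_rtrancl edge)
  have "(u, v) \<in> R\<^sup>*" if "u < n" "v < n" for u v
    using *[OF that(1)] *[OF that(2)] sym_rtrancl[OF \<open>sym R\<close>]
    by (meson rtrancl_trans symD)
  then show ?thesis
    using assms(1) by (auto simp: connected_graph_def V R_def lessThan_empty_iff)
qed

end

theory Submission
  imports Defs
begin

text \<open>
  Let \<open>h u t x\<close> be the density at \<open>x\<close> of the walk from \<open>u\<close> after \<open>t\<close> steps, relative to the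
  stationary distribution. Averaged over a stationary start \<open>u\<close>, its relative entropy is at most
  \<open>2 ln n\<close> initially, and each step lowers it by at least a multiple of the Dirichlet energy of
  \<open>sqrt (h u t)\<close>. So some time \<open>t \<le> C ln n\<close> has average energy \<open>O(1 / C)\<close>.

  By stationarity, \<open>F x = (\<lambda>u. sqrt (stationary u * h u t x))\<close> is a unit vector for every vertex
  \<open>x\<close>. The random graph need not have a spectral gap, but a.a.s. all sets of linear size have linear
  boundary, and this already forces a map to the unit sphere with small energy to be almost constant
  on most pairs of vertices. Almost constant \<open>F\<close> means small average total variation distance.

  For the isoperimetry, the ring edges suffice unless \<open>S\<close> consists of few intervals; there are few
  such \<open>S\<close>, and a union bound over them shows that the random edges supply the boundary.
\<close>

section \<open>Entropy and weak Poincare inequalities\<close>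

text \<open>A gap fails because the ring typically contains stretches of order \<open>ln n\<close>
  vertices that no random edge touches, and a walk started inside one needs about the square of
  \<open>ln n\<close> steps to leave. Such starts are rare, so the average over \<open>u\<close> can
  still be of order \<open>ln n\<close>. Accordingly every cut condition carries an additive error
  \<open>\<eta>\<close> that forgives sets of small mass. Entropy replaces variance because a point
  mass has chi-square distance of order \<open>n\<close>, and bringing that down in
  \<open>O(ln n)\<close> steps would take a gap. The entropy is only logarithmic, so it is enough
  that the dissipation summed over all times is bounded. The map \<open>F\<close> has as many
  coordinates as there are vertices, so the Poincare-type inequality must not depend on the
  dimension; random signs reduce it to scalar functions, at a price measured by a fourth moment. The
  constants are fixed in the order \<open>\<omega>\<close>, \<open>M\<close>, \<open>\<eta>\<close>,
  \<open>\<gamma>\<close>, \<open>L\<close>, \<open>c\<close>, \<open>\<alpha>\<close>,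
  \<open>C\<close>, each from earlier ones and from \<open>k\<close>, \<open>\<epsilon>\<close>,
  \<open>\<delta>\<close> only.\<close>

lemma mult_ln_ge_sqrt:
  fixes h g :: real
  assumes "h \<ge> 0" "g > 0"
  shows "h * ln g + 2 * (h - sqrt h * sqrt g) \<le> h * ln h"
proof (cases "h = 0")
  case False
  then have h: "h > 0" using assms by simp
  \<comment> \<open>Taking \<open>ln s \<le> s - 1\<close> at the square root of
    \<open>g / h\<close>, rather than at \<open>g / h\<close>, is what brings in the Hellinger-type
    term.\<close>
  have "ln (sqrt (g / h)) \<le> sqrt (g / h) - 1"
    by (rule ln_le_minus_one) (use h assms in simp)
  moreover have "ln (sqrt (g / h)) = (ln g - ln h) / 2"
    using h assms by (simp add: ln_sqrt ln_div)
  ultimately have "h * (ln g - ln h) \<le> h * (2 * (sqrt (g / h) - 1))"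
    using h by (intro mult_left_mono) auto
  moreover have "h * sqrt (g / h) = sqrt h * sqrt g"
  proof -
    have "h * sqrt (g / h) = (sqrt h * sqrt h) * (sqrt g / sqrt h)"
      using h by (simp add: real_sqrt_divide)
    also have "\<dots> = sqrt h * sqrt g"
      using h by (metis mult.assoc nonzero_mult_div_cancel_left real_sqrt_eq_zero_cancel_iff
          less_irrefl times_divide_eq_right)
    finally show ?thesis .
  qed
  ultimately show ?thesis by (simp add: algebra_simps)
qed (use assms in simp)

text \<open>A quantitative Jensen inequality for \<open>h * ln h\<close>. Averaging
  \<open>mult_ln_ge_sqrt\<close> with \<open>g\<close> the mean works because the left side equals
  \<open>2 * (g - r)\<close>, where \<open>r\<close> is the mean of \<open>sqrt h * sqrt g\<close>.
  If \<open>g = 0\<close>, then \<open>h\<close> vanishes wherever \<open>q\<close> does not and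
  both sides are 0.\<close>

lemma entropy_gap_ge_sqrt:
  fixes q h :: "'a \<Rightarrow> real"
  assumes "finite A" and q: "\<And>x. x \<in> A \<Longrightarrow> q x \<ge> 0" and q1: "(\<Sum>x\<in>A. q x) = 1"
    and h: "\<And>x. x \<in> A \<Longrightarrow> h x \<ge> 0" and g: "g = (\<Sum>x\<in>A. q x * h x)"
  shows "(\<Sum>x\<in>A. q x * (sqrt (h x) - sqrt g)\<^sup>2) \<le> (\<Sum>x\<in>A. q x * (h x * ln (h x))) - g * ln g"
proof -
  have g0: "g \<ge> 0" unfolding g by (intro sum_nonneg) (simp add: q h)
  show ?thesis
  proof (cases "g = 0")
    case True
    have "\<forall>x\<in>A. q x * h x = 0"
      using sum_nonneg_eq_0_iff[OF assms(1), of "\<lambda>x. q x * h x"] q h True g by simp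
    then have z: "q x = 0 \<or> h x = 0" if "x \<in> A" for x
      using that by simp
    have "(\<Sum>x\<in>A. q x * (sqrt (h x) - sqrt g)\<^sup>2) = 0"
      unfolding True using z by (intro sum.neutral ballI) fastforce
    moreover have "(\<Sum>x\<in>A. q x * (h x * ln (h x))) = 0"
      using z by (intro sum.neutral ballI) fastforce
    ultimately show ?thesis unfolding True by simp
  next
    case False
    then have gp: "g > 0" using g0 by simp
    define r where "r = (\<Sum>x\<in>A. q x * (sqrt (h x) * sqrt g))"
    have sq: "(sqrt (h x) - sqrt g)\<^sup>2 = h x - 2 * (sqrt (h x) * sqrt g) + g" if "x \<in> A" for x
      using h[OF that] gp by (simp add: power2_diff)
    have "(\<Sum>x\<in>A. q x * (sqrt (h x) - sqrt g)\<^sup>2)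
        = (\<Sum>x\<in>A. q x * h x - 2 * q x * (sqrt (h x) * sqrt g) + g * q x)"
      by (intro sum.cong refl) (simp add: sq algebra_simps)
    also have "\<dots> = (\<Sum>x\<in>A. q x * h x) - 2 * r + g * (\<Sum>x\<in>A. q x)"
      unfolding r_def by (simp only: sum.distrib sum_subtractf sum_distrib_left mult.assoc)
    also have "\<dots> = 2 * (g - r)" unfolding q1 g[symmetric] by simp
    also have "\<dots> = (\<Sum>x\<in>A. q x * (h x * ln g + 2 * (h x - sqrt (h x) * sqrt g))) - g * ln g"
    proof -
      have "(\<Sum>x\<in>A. q x * (h x * ln g + 2 * (h x - sqrt (h x) * sqrt g)))
          = (\<Sum>x\<in>A. q x * h x * ln g + 2 * (q x * h x) - 2 * (q x * (sqrt (h x) * sqrt g)))"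
        by (intro sum.cong refl) (simp add: algebra_simps)
      also have "\<dots> = (\<Sum>x\<in>A. q x * h x) * ln g + 2 * (\<Sum>x\<in>A. q x * h x) - 2 * r"
        unfolding r_def by (simp only: sum.distrib sum_subtractf sum_distrib_left sum_distrib_right)
      also have "\<dots> = g * ln g + 2 * (g - r)" unfolding g[symmetric] by simp
      finally show ?thesis by simp
    qed
    also have "\<dots> \<le> (\<Sum>x\<in>A. q x * (h x * ln (h x))) - g * ln g"
      using q h gp by (intro diff_right_mono sum_mono mult_left_mono mult_ln_ge_sqrt) auto
    finally show ?thesis .
  qed
qed

text \<open>A Rademacher sum: \<open>A\<close> is the set of coordinates with sign plus. Expectation
  over uniform signs is encoded as a plain sum over \<open>Pow U\<close>, so factors
  \<open>2 ^ card U\<close> take the place of a probability space.\<close>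

definition signed_sum :: "'a set \<Rightarrow> ('a \<Rightarrow> real) \<Rightarrow> 'a set \<Rightarrow> real" where
  "signed_sum U a A = (\<Sum>u\<in>U. if u \<in> A then a u else - a u)"

lemma signed_sum_diff: "signed_sum U (\<lambda>u. a u - b u) A = signed_sum U a A - signed_sum U b A"
  unfolding signed_sum_def sum_subtractf[symmetric] by (rule sum.cong) auto

lemma sum_Pow_insert:
  assumes "finite U" "v \<notin> U"
  shows "(\<Sum>A\<in>Pow (insert v U). f A) = (\<Sum>A\<in>Pow U. f A + f (insert v A))"
proof -
  have "inj_on (insert v) (Pow U)"
    using assms(2) by (auto intro!: inj_onI)
  moreover have "Pow U \<inter> insert v ` Pow U = {}" using assms(2) by auto
  ultimately show ?thesis
    using assms(1) by (simp add: Pow_insert sum.union_disjoint sum.reindex sum.distrib)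
qed

lemma signed_sum_insert:
  assumes "finite U" "v \<notin> U" "A \<subseteq> U"
  shows "signed_sum (insert v U) a A = signed_sum U a A - a v"
    and "signed_sum (insert v U) a (insert v A) = signed_sum U a A + a v"
proof -
  have *: "(\<Sum>u\<in>U. if u \<in> insert v A then a u else - a u) = signed_sum U a A"
    unfolding signed_sum_def using assms by (intro sum.cong) auto
  show "signed_sum (insert v U) a A = signed_sum U a A - a v"
    using assms unfolding signed_sum_def by auto
  show "signed_sum (insert v U) a (insert v A) = signed_sum U a A + a v"
    using assms * unfolding signed_sum_def by auto
qed

lemma signed_sum_second_moment:
  assumes "finite U"
  shows "(\<Sum>A\<in>Pow U. (signed_sum U a A)\<^sup>2) = 2 ^ card U * (\<Sum>u\<in>U. (a u)\<^sup>2)"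
  using assms
proof (induction U)
  case empty
  then show ?case by (simp add: signed_sum_def)
next
  case (insert v U)
  have "(\<Sum>A\<in>Pow (insert v U). (signed_sum (insert v U) a A)\<^sup>2)
      = (\<Sum>A\<in>Pow U. 2 * (signed_sum U a A)\<^sup>2 + 2 * (a v)\<^sup>2)"
    unfolding sum_Pow_insert[OF insert.hyps]
    by (intro sum.cong refl)
       (use insert.hyps in \<open>simp add: signed_sum_insert power2_eq_square algebra_simps\<close>)
  also have "\<dots> = 2 * (2 ^ card U * (\<Sum>u\<in>U. (a u)\<^sup>2)) + 2 ^ card U * (2 * (a v)\<^sup>2)"
    by (simp add: sum.distrib sum_distrib_left[symmetric] insert.IH card_Pow insert.hyps)
  also have "\<dots> = 2 ^ card (insert v U) * (\<Sum>u\<in>insert v U. (a u)\<^sup>2)"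
    using insert.hyps by (simp add: algebra_simps)
  finally show ?case .
qed

text \<open>The Khintchine bound with constant 3, independent of the number of coordinates. Adding a
  coordinate with both signs cancels all odd powers of it.\<close>

lemma signed_sum_fourth_moment:
  assumes "finite U"
  shows "(\<Sum>A\<in>Pow U. (signed_sum U a A) ^ 4) \<le> 3 * 2 ^ card U * (\<Sum>u\<in>U. (a u)\<^sup>2)\<^sup>2"
  using assms
proof (induction U)
  case empty
  then show ?case by (simp add: signed_sum_def)
next
  case (insert v U)
  let ?s = "\<Sum>u\<in>U. (a u)\<^sup>2"
  have "(\<Sum>A\<in>Pow (insert v U). (signed_sum (insert v U) a A) ^ 4)
      = (\<Sum>A\<in>Pow U. 2 * (signed_sum U a A) ^ 4 + 12 * (a v)\<^sup>2 * (signed_sum U a A)\<^sup>2 + 2 * (a v) ^ 4)"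
    unfolding sum_Pow_insert[OF insert.hyps]
    by (intro sum.cong refl)
       (use insert.hyps in \<open>simp add: signed_sum_insert eval_nat_numeral algebra_simps\<close>)
  also have "\<dots> = 2 * (\<Sum>A\<in>Pow U. (signed_sum U a A) ^ 4) + 12 * (a v)\<^sup>2 * (2 ^ card U * ?s)
      + 2 ^ card U * (2 * (a v) ^ 4)"
    by (simp add: sum.distrib sum_distrib_left[symmetric] card_Pow insert.hyps
        signed_sum_second_moment)
  \<comment> \<open>Raising the coefficient of the last term from 2 to 6 completes the square on the
    right.\<close>
  also have "\<dots> \<le> 2 * (3 * 2 ^ card U * ?s\<^sup>2) + 12 * (a v)\<^sup>2 * (2 ^ card U * ?s)
      + 2 ^ card U * (6 * (a v) ^ 4)"
    using insert.IH by (intro add_mono mult_left_mono) auto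
  also have "\<dots> = 3 * 2 ^ card (insert v U) * (\<Sum>u\<in>insert v U. (a u)\<^sup>2)\<^sup>2"
    using insert.hyps by (simp add: eval_nat_numeral algebra_simps)
  finally show ?case .
qed

text \<open>Apply the hypothesis to the superlevel sets of \<open>g\<close> and integrate over the level in \<open>[- M, M]\<close>.\<close>
lemma coarea_le:
  fixes c :: "'a \<Rightarrow> 'a \<Rightarrow> real" and g :: "'a \<Rightarrow> real"
  assumes "finite V" and cut: "\<And>S. S \<subseteq> V \<Longrightarrow> (\<Sum>x\<in>S. \<Sum>y\<in>V - S. c x y) \<le> \<eta>"
    and g: "\<And>x. x \<in> V \<Longrightarrow> \<bar>g x\<bar> \<le> M" and "M \<ge> 0"
  shows "(\<Sum>x\<in>V. \<Sum>y\<in>V. c x y * max 0 (g x - g y)) \<le> 2 * M * \<eta>"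
proof -
  have int: "measure lborel {b<..a} = max 0 (a - b)" for a b :: real
    by (cases "b \<le> a") (auto simp: max_def)
  have intb: "integrable lborel (\<lambda>t. indicator {b<..a} t :: real)" for a b :: real
    by (cases "b \<le> a") (auto intro!: integrable_real_indicator)
  have pw: "(\<Sum>x\<in>V. \<Sum>y\<in>V. c x y * indicator {g y<..g x} t) \<le> \<eta> * indicator {-M<..M} t" for t
  proof -
    define S where "S = {x \<in> V. t \<le> g x}"
    have S: "S \<subseteq> V" by (auto simp: S_def)
    have "(\<Sum>x\<in>V. \<Sum>y\<in>V. c x y * indicator {g y<..g x} t)
        = (\<Sum>x\<in>V. if x \<in> S then \<Sum>y\<in>V. if y \<in> V - S then c x y else 0 else 0)"
      by (intro sum.cong refl) (auto simp: S_def indicator_def intro!: sum.cong)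
    also have "\<dots> = (\<Sum>x\<in>S. \<Sum>y\<in>V - S. c x y)"
    proof -
      have "(\<Sum>y\<in>V. if y \<in> V - S then c x y else 0) = (\<Sum>y\<in>V - S. c x y)" for x
        using sum.inter_restrict[OF assms(1), of "c x" "V - S"] by (simp add: Int_absorb1)
      then show ?thesis
        using sum.inter_restrict[OF assms(1), of "\<lambda>x. \<Sum>y\<in>V - S. c x y" S] S
        by (simp only: Int_absorb1)
    qed
    finally have eq: "(\<Sum>x\<in>V. \<Sum>y\<in>V. c x y * indicator {g y<..g x} t) = (\<Sum>x\<in>S. \<Sum>y\<in>V - S. c x y)" .
    show ?thesis
    \<comment> \<open>At other levels the superlevel set is empty or all of \<open>V\<close> and
      cuts nothing, so \<open>\<eta>\<close> is paid only on a range of length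
      \<open>2 * M\<close>.\<close>
    proof (cases "t \<in> {-M<..M}")
      case True
      then show ?thesis using cut[OF S] eq by simp
    next
      case False
      then consider "t \<le> -M" | "t > M" by fastforce
      then have "S = {} \<or> V - S = {}"
        using g by cases (fastforce simp: S_def abs_le_iff)+
      then have "(\<Sum>x\<in>S. \<Sum>y\<in>V - S. c x y) = 0" by (elim disjE) (simp_all only: sum.empty sum.neutral_const)
      then show ?thesis using eq False by auto
    qed
  qed
  have "(\<Sum>x\<in>V. \<Sum>y\<in>V. c x y * max 0 (g x - g y))
      = integral\<^sup>L lborel (\<lambda>t. \<Sum>x\<in>V. \<Sum>y\<in>V. c x y * indicator {g y<..g x} t)"
    by (simp add: Bochner_Integration.integral_sum intb int integrable_sum)
  also have "\<dots> \<le> integral\<^sup>L lborel (\<lambda>t. \<eta> * indicator {-M<..M} t)"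
    by (intro integral_mono pw Bochner_Integration.integrable_sum integrable_mult_right intb)
  also have "\<dots> = 2 * M * \<eta>"
    using \<open>M \<ge> 0\<close> by (simp add: int)
  finally show ?thesis .
qed

section \<open>Truncation and the weak Poincare inequalities\<close>

definition clip :: "real \<Rightarrow> real \<Rightarrow> real" where
  "clip M z = max (- M) (min M z)"

lemma abs_clip_le: "M \<ge> 0 \<Longrightarrow> \<bar>clip M z\<bar> \<le> M"
  by (auto simp: clip_def)

lemma abs_clip_diff_le: "\<bar>clip M y - clip M z\<bar> \<le> \<bar>y - z\<bar>"
  by (auto simp: clip_def)

text \<open>The error vanishes for \<open>\<bar>z\<bar> \<le> M\<close>; beyond that it is at most
  \<open>\<bar>z\<bar>\<close>, and a factor \<open>z\<^sup>2 / M\<^sup>2 \<ge> 1\<close> can be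
  afforded.\<close>

lemma clip_error_le:
  assumes "M > 0"
  shows "(z - clip M z)\<^sup>2 \<le> z ^ 4 / M\<^sup>2"
proof (cases "\<bar>z\<bar> \<le> M")
  case True
  then show ?thesis using assms by (auto simp: clip_def)
next
  case False
  then have "\<bar>z - clip M z\<bar> \<le> \<bar>z\<bar>" using assms by (auto simp: clip_def)
  then have "(z - clip M z)\<^sup>2 * M\<^sup>2 \<le> z\<^sup>2 * z\<^sup>2"
    using False assms by (intro mult_mono) (auto simp: abs_le_square_iff[symmetric])
  then show ?thesis using assms by (simp add: pos_le_divide_eq power4_eq_xxxx power2_eq_square mult.assoc)
qed

text \<open>Level sets yield first powers of differences, whereas the energy controls squares. The
  parameter \<open>\<alpha>\<close> trades one for the other and is later taken large, so that the
  leftover \<open>1 / (2 * \<alpha>)\<close> per edge is small.\<close>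

lemma abs_le_weighted_square:
  fixes z \<alpha> :: real
  assumes "\<alpha> > 0"
  shows "\<bar>z\<bar> \<le> \<alpha> / 2 * z\<^sup>2 + 1 / (2 * \<alpha>)"
proof -
  have "0 \<le> (\<alpha> * \<bar>z\<bar> - 1)\<^sup>2 / (2 * \<alpha>)" using assms by simp
  also have "\<dots> = \<alpha> / 2 * z\<^sup>2 + 1 / (2 * \<alpha>) - \<bar>z\<bar>"
    using assms by (simp add: power2_eq_square field_simps)
  finally show ?thesis by simp
qed

text \<open>For functions bounded by \<open>M\<close>, squared differences are at most
  \<open>2 * M\<close> times absolute ones. These split into two one-sided parts with equal totals,
  and the coarea bound controls one of them.\<close>

lemma bounded_weak_poincare:
  fixes p :: "'a \<Rightarrow> real" and e :: "'a \<Rightarrow> 'a \<Rightarrow> real"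
  assumes "finite V" and p: "\<And>x. x \<in> V \<Longrightarrow> p x \<ge> 0" and e: "\<And>x y. e x y \<ge> 0"
    and cut: "\<And>S. S \<subseteq> V \<Longrightarrow> sum p S * sum p (V - S) \<le> \<eta> + (\<Sum>x\<in>S. \<Sum>y\<in>V - S. e x y)"
    and g: "\<And>x. x \<in> V \<Longrightarrow> \<bar>g x\<bar> \<le> M" and M: "M \<ge> 0" and "\<alpha> > 0"
  shows "(\<Sum>x\<in>V. \<Sum>y\<in>V. p x * p y * (g x - g y)\<^sup>2)
    \<le> 4 * M * (2 * M * \<eta> + (\<Sum>x\<in>V. \<Sum>y\<in>V. e x y * (\<alpha> / 2 * (g x - g y)\<^sup>2 + 1 / (2 * \<alpha>))))"
proof -
  let ?P = "\<Sum>x\<in>V. \<Sum>y\<in>V. p x * p y * max 0 (g x - g y)"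
  \<comment> \<open>The weight in \<open>coarea_le\<close> may have any sign, so both sides of the
    cut condition enter as a single difference.\<close>
  have "(\<Sum>x\<in>V. \<Sum>y\<in>V. (p x * p y - e x y) * max 0 (g x - g y)) \<le> 2 * M * \<eta>"
    using assms(1) _ g M
  proof (rule coarea_le)
    fix S assume "S \<subseteq> V"
    from cut[OF this] show "(\<Sum>x\<in>S. \<Sum>y\<in>V - S. p x * p y - e x y) \<le> \<eta>"
      by (simp add: sum_subtractf sum_product)
  qed
  then have "?P \<le> 2 * M * \<eta> + (\<Sum>x\<in>V. \<Sum>y\<in>V. e x y * max 0 (g x - g y))"
    by (simp add: algebra_simps sum_subtractf)
  also have "\<dots> \<le> 2 * M * \<eta> + (\<Sum>x\<in>V. \<Sum>y\<in>V. e x y * (\<alpha> / 2 * (g x - g y)\<^sup>2 + 1 / (2 * \<alpha>)))"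
  proof (intro add_left_mono sum_mono mult_left_mono e)
    fix x y
    show "max 0 (g x - g y) \<le> \<alpha> / 2 * (g x - g y)\<^sup>2 + 1 / (2 * \<alpha>)"
      using abs_le_weighted_square[OF \<open>\<alpha> > 0\<close>, of "g x - g y"] by linarith
  qed
  finally have P: "?P \<le> \<dots>" .
  have swap: "?P = (\<Sum>x\<in>V. \<Sum>y\<in>V. p x * p y * max 0 (g y - g x))"
    by (subst sum.swap) (simp add: mult.commute)
  have "(\<Sum>x\<in>V. \<Sum>y\<in>V. p x * p y * (g x - g y)\<^sup>2)
      \<le> (\<Sum>x\<in>V. \<Sum>y\<in>V. p x * p y * (2 * M * (max 0 (g x - g y) + max 0 (g y - g x))))"
  proof (intro sum_mono mult_left_mono)
    fix x y assume xy: "x \<in> V" "y \<in> V"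
    have "\<bar>g x - g y\<bar> * \<bar>g x - g y\<bar> \<le> (2 * M) * \<bar>g x - g y\<bar>"
      using g[OF xy(1)] g[OF xy(2)] by (intro mult_right_mono) auto
    moreover have "\<bar>g x - g y\<bar> = max 0 (g x - g y) + max 0 (g y - g x)" by auto
    ultimately show "(g x - g y)\<^sup>2 \<le> 2 * M * (max 0 (g x - g y) + max 0 (g y - g x))"
      by (metis abs_mult_self_eq power2_eq_square)
  qed (use p in simp)
  also have "\<dots> = 2 * M * (?P + (\<Sum>x\<in>V. \<Sum>y\<in>V. p x * p y * max 0 (g y - g x)))"
    unfolding sum.distrib[symmetric] sum_distrib_left
    by (intro sum.cong refl) (simp only: distrib_left mult_ac)
  also have "\<dots> = 2 * M * (?P + ?P)"
    by (simp only: swap[symmetric])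
  also have "\<dots> = 4 * M * ?P" by simp
  also have "\<dots> \<le> 4 * M * (2 * M * \<eta> + (\<Sum>x\<in>V. \<Sum>y\<in>V. e x y * (\<alpha> / 2 * (g x - g y)\<^sup>2 + 1 / (2 * \<alpha>))))"
    using P M by (intro mult_left_mono) auto
  finally show ?thesis .
qed

lemma sum_rotate3:
  "(\<Sum>a\<in>A. \<Sum>x\<in>X. \<Sum>y\<in>Y. f a x y) = (\<Sum>x\<in>X. \<Sum>y\<in>Y. \<Sum>a\<in>A. f a x y)"
  by (rule trans[OF sum.swap]) (intro sum.cong refl sum.swap)

text \<open>
  Coordinates of \<open>F\<close> are not bounded, but a random signed combination of them has bounded fourth
  moment, so clipping it costs little and the scalar inequality applies.
\<close>
lemma sphere_weak_poincare:
  fixes p :: "'a \<Rightarrow> real" and e :: "'a \<Rightarrow> 'a \<Rightarrow> real" and F :: "'b \<Rightarrow> 'a \<Rightarrow> real"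
  assumes "finite V" "finite U" and p: "\<And>x. x \<in> V \<Longrightarrow> p x \<ge> 0" and p1: "sum p V = 1"
    and e: "\<And>x y. e x y \<ge> 0"
    and cut: "\<And>S. S \<subseteq> V \<Longrightarrow> sum p S * sum p (V - S) \<le> \<eta> + (\<Sum>x\<in>S. \<Sum>y\<in>V - S. e x y)"
    and F: "\<And>x. x \<in> V \<Longrightarrow> (\<Sum>u\<in>U. (F u x)\<^sup>2) = 1" and M: "M > 0" and \<alpha>: "\<alpha> > 0"
  shows "(\<Sum>x\<in>V. \<Sum>y\<in>V. p x * p y * (\<Sum>u\<in>U. (F u x - F u y)\<^sup>2))
    \<le> 8 * M * (2 * M * \<eta> + (\<Sum>x\<in>V. \<Sum>y\<in>V. e x y * (\<alpha> / 2 * (\<Sum>u\<in>U. (F u x - F u y)\<^sup>2) + 1 / (2 * \<alpha>))))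
      + 24 / M\<^sup>2" (is "?W \<le> 8 * M * (2 * M * \<eta> + ?Q) + _")
proof -
  define N :: real where "N = 2 ^ card U"
  have N: "N > 0" by (simp add: N_def)
  define z where "z A x = signed_sum U (\<lambda>u. F u x) A" for A x
  define g where "g A x = clip M (z A x)" for A x
  define S where "S x y = (\<Sum>u\<in>U. (F u x - F u y)\<^sup>2)" for x y
  define Q where "Q = (\<Sum>x\<in>V. \<Sum>y\<in>V. e x y * (\<alpha> / 2 * S x y + 1 / (2 * \<alpha>)))"
  have z2: "(\<Sum>A\<in>Pow U. (z A x - z A y)\<^sup>2) = N * S x y" for x y
    using signed_sum_second_moment[OF assms(2), of "\<lambda>u. F u x - F u y"]
    by (simp add: N_def z_def S_def signed_sum_diff)
  have tail: "(\<Sum>A\<in>Pow U. (z A x - g A x)\<^sup>2) \<le> 3 * N / M\<^sup>2" if "x \<in> V" for x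
  proof -
    have "(\<Sum>A\<in>Pow U. (z A x - g A x)\<^sup>2) \<le> (\<Sum>A\<in>Pow U. z A x ^ 4 / M\<^sup>2)"
      unfolding g_def by (intro sum_mono clip_error_le M)
    also have "\<dots> = (\<Sum>A\<in>Pow U. z A x ^ 4) / M\<^sup>2"
      by (simp add: sum_divide_distrib)
    also have "\<dots> \<le> 3 * N / M\<^sup>2"
      using signed_sum_fourth_moment[OF assms(2), of "\<lambda>u. F u x"] F[OF that]
      by (intro divide_right_mono) (auto simp: z_def N_def)
    finally show ?thesis .
  qed
  have pair: "N * S x y \<le> 2 * (\<Sum>A\<in>Pow U. (g A x - g A y)\<^sup>2) + 24 * N / M\<^sup>2"
    if "x \<in> V" "y \<in> V" for x y
  proof -
    \<comment> \<open>Triangle inequality through the clipped values. With weight 4 on each of two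
      tails of size \<open>3 * N / M\<^sup>2\<close> it produces the constant 24.\<close>
    have "(a - b)\<^sup>2 \<le> 2 * (c - d)\<^sup>2 + 4 * (a - c)\<^sup>2 + 4 * (b - d)\<^sup>2" for a b c d :: real
    proof -
      have "0 \<le> ((c - d) - ((a - c) - (b - d)))\<^sup>2 + 2 * ((a - c) + (b - d))\<^sup>2" by simp
      then show ?thesis by (simp add: power2_eq_square algebra_simps)
    qed
    then have "N * S x y \<le> (\<Sum>A\<in>Pow U. 2 * (g A x - g A y)\<^sup>2 + 4 * (z A x - g A x)\<^sup>2 + 4 * (z A y - g A y)\<^sup>2)"
      unfolding z2[symmetric] by (intro sum_mono)
    also have "\<dots> = 2 * (\<Sum>A\<in>Pow U. (g A x - g A y)\<^sup>2) + 4 * (\<Sum>A\<in>Pow U. (z A x - g A x)\<^sup>2)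
        + 4 * (\<Sum>A\<in>Pow U. (z A y - g A y)\<^sup>2)"
      by (simp add: sum.distrib sum_distrib_left)
    also have "\<dots> \<le> 2 * (\<Sum>A\<in>Pow U. (g A x - g A y)\<^sup>2) + 4 * (3 * N / M\<^sup>2) + 4 * (3 * N / M\<^sup>2)"
      using that by (intro add_mono mult_left_mono tail order_refl) auto
    finally show ?thesis by simp
  qed
  have scalar: "(\<Sum>x\<in>V. \<Sum>y\<in>V. p x * p y * (g A x - g A y)\<^sup>2)
      \<le> 4 * M * (2 * M * \<eta> + (\<Sum>x\<in>V. \<Sum>y\<in>V. e x y * (\<alpha> / 2 * (z A x - z A y)\<^sup>2 + 1 / (2 * \<alpha>))))" for A
  proof -
    have "(\<Sum>x\<in>V. \<Sum>y\<in>V. p x * p y * (g A x - g A y)\<^sup>2)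
      \<le> 4 * M * (2 * M * \<eta> + (\<Sum>x\<in>V. \<Sum>y\<in>V. e x y * (\<alpha> / 2 * (g A x - g A y)\<^sup>2 + 1 / (2 * \<alpha>))))"
      using M by (intro bounded_weak_poincare assms) (auto simp: g_def abs_clip_le)
    \<comment> \<open>Clipping is 1-Lipschitz, so the energy may be taken of the unclipped sums,
      whose second moment over \<open>A\<close> is known exactly.\<close>
    also have "\<dots> \<le> 4 * M * (2 * M * \<eta> + (\<Sum>x\<in>V. \<Sum>y\<in>V. e x y * (\<alpha> / 2 * (z A x - z A y)\<^sup>2 + 1 / (2 * \<alpha>))))"
      using M \<alpha> by (intro mult_left_mono add_left_mono sum_mono add_right_mono e)
        (auto simp: g_def intro!: abs_clip_diff_le[THEN abs_le_square_iff[THEN iffD1]])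
    finally show ?thesis .
  qed
  have avg: "(\<Sum>A\<in>Pow U. \<Sum>x\<in>V. \<Sum>y\<in>V. e x y * (\<alpha> / 2 * (z A x - z A y)\<^sup>2 + 1 / (2 * \<alpha>)))
      = N * Q"
  proof -
    have "(\<Sum>A\<in>Pow U. e x y * (\<alpha> / 2 * (z A x - z A y)\<^sup>2 + 1 / (2 * \<alpha>)))
        = N * (e x y * (\<alpha> / 2 * S x y + 1 / (2 * \<alpha>)))" for x y
    proof -
      have "(\<Sum>A\<in>Pow U. e x y * (\<alpha> / 2 * (z A x - z A y)\<^sup>2 + 1 / (2 * \<alpha>)))
          = e x y * (\<alpha> / 2 * (\<Sum>A\<in>Pow U. (z A x - z A y)\<^sup>2) + (\<Sum>A\<in>Pow U. 1 / (2 * \<alpha>)))"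
        by (simp only: sum_distrib_left[of "e x y"] sum_distrib_left[of "\<alpha> / 2"] sum.distrib distrib_left)
      also have "(\<Sum>A\<in>Pow U. 1 / (2 * \<alpha>)) = N * (1 / (2 * \<alpha>))"
        by (simp add: card_Pow assms(2) N_def)
      finally show ?thesis by (simp only: z2) (simp add: algebra_simps)
    qed
    then show ?thesis unfolding Q_def sum_distrib_left[of N]
      by (subst sum_rotate3) (intro sum.cong refl)
  qed
  have "N * ?W = (\<Sum>x\<in>V. \<Sum>y\<in>V. p x * p y * (N * S x y))"
    unfolding S_def[symmetric] sum_distrib_left[of N] by (intro sum.cong refl mult.left_commute)
  also have "\<dots> \<le> (\<Sum>x\<in>V. \<Sum>y\<in>V. p x * p y * (2 * (\<Sum>A\<in>Pow U. (g A x - g A y)\<^sup>2) + 24 * N / M\<^sup>2))"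
    using p by (intro sum_mono mult_left_mono pair) auto
  also have "\<dots> = 2 * (\<Sum>x\<in>V. \<Sum>y\<in>V. \<Sum>A\<in>Pow U. p x * p y * (g A x - g A y)\<^sup>2)
      + (\<Sum>x\<in>V. \<Sum>y\<in>V. p x * p y) * (24 * N / M\<^sup>2)"
  proof -
    have "p x * p y * (2 * (\<Sum>A\<in>Pow U. (g A x - g A y)\<^sup>2) + 24 * N / M\<^sup>2)
      = 2 * (\<Sum>A\<in>Pow U. p x * p y * (g A x - g A y)\<^sup>2) + p x * p y * (24 * N / M\<^sup>2)" for x y
      by (simp add: sum_distrib_left[symmetric] distrib_left)
    then show ?thesis
      unfolding sum_distrib_left[of 2] sum_distrib_right sum.distrib[symmetric]
      by (intro sum.cong refl)
  qed
  also have "(\<Sum>x\<in>V. \<Sum>y\<in>V. p x * p y) = 1"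
    using sum_product[of p V p V] p1 by simp
  also have "2 * (\<Sum>x\<in>V. \<Sum>y\<in>V. \<Sum>A\<in>Pow U. p x * p y * (g A x - g A y)\<^sup>2)
      = 2 * (\<Sum>A\<in>Pow U. \<Sum>x\<in>V. \<Sum>y\<in>V. p x * p y * (g A x - g A y)\<^sup>2)"
    by (subst sum_rotate3) (rule refl)
  also have "\<dots> \<le> 2 * (\<Sum>A\<in>Pow U. 4 * M * (2 * M * \<eta>
      + (\<Sum>x\<in>V. \<Sum>y\<in>V. e x y * (\<alpha> / 2 * (z A x - z A y)\<^sup>2 + 1 / (2 * \<alpha>)))))"
    by (intro mult_left_mono sum_mono scalar) auto
  also have "\<dots> = 8 * M * (N * (2 * M * \<eta>) + N * Q)"
  proof -
    have lin: "(\<Sum>A\<in>Pow U. 4 * M * (2 * M * \<eta> + B A)) = 4 * M * (N * (2 * M * \<eta>) + (\<Sum>A\<in>Pow U. B A))" for B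
      by (simp add: sum_distrib_left[symmetric] sum.distrib card_Pow assms(2) N_def)
    show ?thesis unfolding lin avg by simp
  qed
  finally have "N * ?W \<le> 8 * M * (N * (2 * M * \<eta>) + N * Q) + 1 * (24 * N / M\<^sup>2)" by simp
  also have "\<dots> = N * (8 * M * (2 * M * \<eta> + Q) + 24 / M\<^sup>2)"
    by (simp add: field_simps)
  finally have "N * ?W \<le> N * (8 * M * (2 * M * \<eta> + ?Q) + 24 / M\<^sup>2)"
    by (simp only: Q_def S_def)
  then show ?thesis using N by simp
qed

section \<open>Entropy decay of the lazy walk\<close>

text \<open>Positive degrees make \<open>stationary\<close> positive, so densities can be formed by
  division. Connectivity enters later, quantitatively, as a cut hypothesis.\<close>

locale finite_graph =
  fixes H :: "'a sgraph"
  assumes finite_verts: "finite (verts H)"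
    and verts_nonempty: "verts H \<noteq> {}"
    and edge_pair: "\<And>e. e \<in> edges H \<Longrightarrow> e \<subseteq> verts H \<and> card e = 2"
    and degree_pos: "\<And>v. v \<in> verts H \<Longrightarrow> degree H v > 0"
begin

abbreviation V where "V \<equiv> verts H"

abbreviation m :: real where "m \<equiv> real (card (edges H))"

definition adj :: "'a \<Rightarrow> 'a \<Rightarrow> real" where
  "adj x y = (if {x, y} \<in> edges H then 1 else 0)"

definition density :: "'a \<Rightarrow> nat \<Rightarrow> 'a \<Rightarrow> real" where
  "density u t x = walk_dist H u t x / stationary H x"

lemma finite_edges: "finite (edges H)"
  by (rule finite_subset[of _ "Pow V"]) (use edge_pair finite_verts in auto)

lemma adj_nonneg: "adj x y \<ge> 0"
  by (simp add: adj_def)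

lemma adj_commute: "adj x y = adj y x"
  by (simp add: adj_def insert_commute)

lemma adj_self: "adj x x = 0"
  using edge_pair[of "{x}"] by (auto simp: adj_def)

lemma sum_adj:
  assumes "x \<in> V"
  shows "(\<Sum>y\<in>V. adj x y) = real (degree H x)"
proof -
  have "bij_betw (\<lambda>y. {x, y}) {y \<in> V. {x, y} \<in> edges H} {e \<in> edges H. x \<in> e}"
    unfolding bij_betw_def
  proof
    show "inj_on (\<lambda>y. {x, y}) {y \<in> V. {x, y} \<in> edges H}"
      by (auto simp: inj_on_def doubleton_eq_iff)
    show "(\<lambda>y. {x, y}) ` {y \<in> V. {x, y} \<in> edges H} = {e \<in> edges H. x \<in> e}"
    proof (intro equalityI subsetI)
      fix e assume e: "e \<in> {e \<in> edges H. x \<in> e}"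
      then obtain a b where ab: "e = {a, b}" using edge_pair[of e] by (auto simp: card_2_iff)
      then obtain y where "e = {x, y}" using e by auto
      then show "e \<in> (\<lambda>y. {x, y}) ` {y \<in> V. {x, y} \<in> edges H}"
        using e edge_pair[of e] by auto
    qed auto
  qed
  then have "card {y \<in> V. {x, y} \<in> edges H} = degree H x"
    unfolding degree_def by (rule bij_betw_same_card)
  then show ?thesis
    using finite_verts by (simp add: adj_def flip: sum.inter_filter)
qed

lemma sum_degree: "(\<Sum>x\<in>V. real (degree H x)) = 2 * m"
proof -
  have "(\<Sum>x\<in>V. card {e \<in> edges H. x \<in> e}) = 2 * card (edges H)"
  proof (rule sum_multicount[OF finite_verts finite_edges], intro ballI)
    fix e assume "e \<in> edges H"
    then have "{x \<in> V. x \<in> e} = e" "card e = 2" using edge_pair[of e] by auto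
    then show "card {x \<in> V. x \<in> e} = 2" by simp
  qed
  then have "real (\<Sum>x\<in>V. degree H x) = real (2 * card (edges H))"
    unfolding degree_def by simp
  then show ?thesis by simp
qed

lemma card_edges_pos: "m > 0"
proof -
  obtain v where v: "v \<in> V" using verts_nonempty by auto
  then have "{e \<in> edges H. v \<in> e} \<noteq> {}"
    using degree_pos[OF v] unfolding degree_def by force
  then show ?thesis using finite_edges by (auto simp: card_gt_0_iff)
qed

lemma stationary_pos: "x \<in> V \<Longrightarrow> stationary H x > 0"
  using degree_pos card_edges_pos by (simp add: stationary_def)

lemma stationary_ge: "x \<in> V \<Longrightarrow> stationary H x \<ge> 1 / (2 * m)"
  using degree_pos[of x] unfolding stationary_def by (intro divide_right_mono) auto

lemma sum_stationary: "(\<Sum>x\<in>V. stationary H x) = 1"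
  unfolding stationary_def sum_divide_distrib[symmetric] sum_degree using card_edges_pos by simp

lemma lazy_walk_eq: "lazy_walk H x y = (if x = y then 1 / 2 else 0) + adj x y / (2 * real (degree H x))"
proof (cases "x = y")
  case True
  then show ?thesis by (simp add: lazy_walk_def adj_self)
next
  case False
  then show ?thesis by (simp add: lazy_walk_def adj_def)
qed

lemma lazy_walk_nonneg: "lazy_walk H x y \<ge> 0"
  by (simp add: lazy_walk_def)

lemma sum_lazy_walk:
  assumes "x \<in> V"
  shows "(\<Sum>y\<in>V. lazy_walk H x y * f y) = f x / 2 + (\<Sum>y\<in>V. adj x y * f y) / (2 * real (degree H x))"
proof -
  have "(\<Sum>y\<in>V. lazy_walk H x y * f y)
      = (\<Sum>y\<in>V. (if x = y then f y / 2 else 0) + adj x y * f y / (2 * real (degree H x)))"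
    by (intro sum.cong refl) (auto simp: lazy_walk_eq distrib_right)
  also have "\<dots> = f x / 2 + (\<Sum>y\<in>V. adj x y * f y) / (2 * real (degree H x))"
    using assms finite_verts by (simp add: sum.distrib sum_divide_distrib)
  finally show ?thesis .
qed

lemma sum_lazy_walk_1:
  assumes "x \<in> V"
  shows "(\<Sum>y\<in>V. lazy_walk H x y) = 1"
  using sum_lazy_walk[OF assms, of "\<lambda>_. 1"] sum_adj[OF assms] degree_pos[OF assms] by simp

lemma reversible:
  assumes "x \<in> V" "y \<in> V"
  shows "stationary H x * lazy_walk H x y = stationary H y * lazy_walk H y x"
proof -
  have "stationary H x * lazy_walk H x y = (if x = y then stationary H x / 2 else 0) + adj x y / (4 * m)"
    if "x \<in> V" for x y
    using degree_pos[OF that] by (cases "x = y") (simp_all add: lazy_walk_eq stationary_def adj_self)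
  from this[OF assms(1)] this[OF assms(2)] show ?thesis by (auto simp: adj_commute)
qed

lemma stationary_step:
  assumes "y \<in> V"
  shows "(\<Sum>x\<in>V. stationary H x * lazy_walk H x y) = stationary H y"
proof -
  have "(\<Sum>x\<in>V. stationary H x * lazy_walk H x y) = (\<Sum>x\<in>V. stationary H y * lazy_walk H y x)"
    using assms by (intro sum.cong refl reversible)
  then show ?thesis using sum_lazy_walk_1[OF assms] by (simp flip: sum_distrib_left)
qed

section \<open>Evolution of the density\<close>

lemma density_0: "density u 0 x = (if x = u then 1 / stationary H u else 0)"
  by (simp add: density_def walk_dist_def)

text \<open>Reversibility turns the forward evolution of the measure into row averages of the
  density. Each new value is thus a mean of old ones, the situation of
  \<open>entropy_gap_ge_sqrt\<close>.\<close>

lemma density_Suc: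
  assumes "y \<in> V"
  shows "density u (Suc t) y = (\<Sum>x\<in>V. lazy_walk H y x * density u t x)"
proof -
  have "walk_dist H u (Suc t) y = (\<Sum>x\<in>V. walk_dist H u t x * lazy_walk H x y)"
    by (simp add: walk_dist_def walk_step_def)
  also have "\<dots> = (\<Sum>x\<in>V. stationary H y * (lazy_walk H y x * density u t x))"
  proof (intro sum.cong refl)
    fix x assume x: "x \<in> V"
    have "walk_dist H u t x * lazy_walk H x y = density u t x * (stationary H x * lazy_walk H x y)"
      using stationary_pos[OF x] by (simp add: density_def)
    then show "walk_dist H u t x * lazy_walk H x y = stationary H y * (lazy_walk H y x * density u t x)"
      unfolding reversible[OF x assms] by (simp only: mult_ac)
  qed
  finally show ?thesis
    using stationary_pos[OF assms] by (simp add: density_def[of u "Suc t"] flip: sum_distrib_left)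
qed

lemma density_nonneg: "x \<in> V \<Longrightarrow> density u t x \<ge> 0"
proof (induction t arbitrary: x)
  case 0
  then show ?case using stationary_pos[of u] by (auto simp: density_0 stationary_def)
next
  case (Suc t)
  then show ?case by (auto simp: density_Suc lazy_walk_nonneg intro!: sum_nonneg)
qed

lemma sum_density:
  assumes "u \<in> V"
  shows "(\<Sum>x\<in>V. stationary H x * density u t x) = 1"
proof (induction t)
  case 0
  have "(\<Sum>x\<in>V. stationary H x * density u 0 x) = (\<Sum>x\<in>V. if x = u then 1 else 0)"
    using stationary_pos by (intro sum.cong refl) (auto simp: density_0 less_imp_neq[symmetric])
  then show ?case using assms finite_verts by simp
next
  case (Suc t)
  have "(\<Sum>y\<in>V. stationary H y * density u (Suc t) y)
      = (\<Sum>y\<in>V. \<Sum>x\<in>V. stationary H y * lazy_walk H y x * density u t x)"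
    by (intro sum.cong refl) (simp add: density_Suc sum_distrib_left mult.assoc)
  also have "\<dots> = (\<Sum>x\<in>V. \<Sum>y\<in>V. stationary H y * lazy_walk H y x * density u t x)"
    by (rule sum.swap)
  also have "\<dots> = (\<Sum>x\<in>V. stationary H x * density u t x)"
    by (intro sum.cong refl) (simp add: stationary_step flip: sum_distrib_right)
  finally show ?case using Suc by simp
qed

text \<open>The sum runs over starts, not over endpoints as in \<open>sum_density\<close>; this is
  the unit norm of \<open>F x\<close>. At time 0 only the start \<open>x\<close> contributes, and
  later values are row averages of earlier ones.\<close>

lemma sum_density_start:
  assumes "x \<in> V"
  shows "(\<Sum>u\<in>V. stationary H u * density u t x) = 1"
  using assms
proof (induction t arbitrary: x)
  case 0
  have "(\<Sum>u\<in>V. stationary H u * density u 0 x) = (\<Sum>u\<in>V. if x = u then 1 else 0)"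
    using stationary_pos by (intro sum.cong refl) (auto simp: density_0 less_imp_neq[symmetric])
  then show ?case using 0 finite_verts by simp
next
  case (Suc t)
  have "(\<Sum>u\<in>V. stationary H u * density u (Suc t) x)
      = (\<Sum>u\<in>V. \<Sum>y\<in>V. lazy_walk H x y * (stationary H u * density u t y))"
    using Suc.prems by (intro sum.cong refl) (simp add: density_Suc sum_distrib_left mult.left_commute)
  also have "\<dots> = (\<Sum>y\<in>V. \<Sum>u\<in>V. lazy_walk H x y * (stationary H u * density u t y))"
    by (rule sum.swap)
  also have "\<dots> = (\<Sum>y\<in>V. lazy_walk H x y)"
    by (intro sum.cong refl) (simp add: Suc.IH flip: sum_distrib_left)
  finally show ?case using sum_lazy_walk_1[OF Suc.prems] by simp
qed

definition entropy :: "('a \<Rightarrow> real) \<Rightarrow> real" where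
  "entropy h = (\<Sum>x\<in>V. stationary H x * (h x * ln (h x)))"

text \<open>The Jensen gap of row \<open>y\<close>, weighted by \<open>stationary H y\<close>, is
  summed over \<open>y\<close>; stationarity turns the averaged old terms into
  \<open>entropy h\<close>. Laziness is essential: staying put has weight \<open>1 / 2\<close>, so
  the gap also controls the distance from \<open>sqrt (h y)\<close> to \<open>sqrt (g y)\<close>,
  and \<open>h y\<close> can be compared with its neighbours through \<open>g y\<close>.\<close>

lemma entropy_step:
  assumes h: "\<And>x. x \<in> V \<Longrightarrow> h x \<ge> 0"
  shows "(\<Sum>y\<in>V. \<Sum>x\<in>V. adj y x * (sqrt (h y) - sqrt (h x))\<^sup>2) / (8 * m)
    \<le> entropy h - entropy (\<lambda>y. \<Sum>x\<in>V. lazy_walk H y x * h x)"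
proof -
  define g where "g y = (\<Sum>x\<in>V. lazy_walk H y x * h x)" for y
  have loc: "(\<Sum>x\<in>V. adj y x * (sqrt (h y) - sqrt (h x))\<^sup>2) / (8 * m)
      \<le> stationary H y * ((\<Sum>x\<in>V. lazy_walk H y x * (h x * ln (h x))) - g y * ln (g y))"
    if y: "y \<in> V" for y
  proof -
    have d: "real (degree H y) > 0" using degree_pos[OF y] by simp
    have "(\<Sum>x\<in>V. adj y x * (sqrt (h y) - sqrt (h x))\<^sup>2)
        \<le> (\<Sum>x\<in>V. adj y x * (2 * ((sqrt (h y) - sqrt (g y))\<^sup>2 + (sqrt (h x) - sqrt (g y))\<^sup>2)))"
    proof (intro sum_mono mult_left_mono adj_nonneg)
      fix x
      have "(a - b)\<^sup>2 \<le> 2 * ((a - c)\<^sup>2 + (b - c)\<^sup>2)" for a b c :: real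
      proof -
        have "0 \<le> (a + b - 2 * c)\<^sup>2" by simp
        then show ?thesis by (simp add: power2_eq_square algebra_simps)
      qed
      then show "(sqrt (h y) - sqrt (h x))\<^sup>2 \<le> 2 * ((sqrt (h y) - sqrt (g y))\<^sup>2 + (sqrt (h x) - sqrt (g y))\<^sup>2)" .
    qed
    also have "\<dots> = 2 * ((\<Sum>x\<in>V. adj y x) * (sqrt (h y) - sqrt (g y))\<^sup>2
        + (\<Sum>x\<in>V. adj y x * (sqrt (h x) - sqrt (g y))\<^sup>2))"
      by (simp add: distrib_left sum.distrib sum_distrib_left sum_distrib_right mult.left_commute)
    also have "\<dots> = 4 * real (degree H y) * (\<Sum>x\<in>V. lazy_walk H y x * (sqrt (h x) - sqrt (g y))\<^sup>2)"
      unfolding sum_lazy_walk[OF y] sum_adj[OF y] using d by (simp add: field_simps)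
    also have "\<dots> \<le> 4 * real (degree H y) * ((\<Sum>x\<in>V. lazy_walk H y x * (h x * ln (h x))) - g y * ln (g y))"
      using y h by (intro mult_left_mono entropy_gap_ge_sqrt)
        (auto simp: finite_verts lazy_walk_nonneg sum_lazy_walk_1 g_def)
    finally have "(\<Sum>x\<in>V. adj y x * (sqrt (h y) - sqrt (h x))\<^sup>2) / (8 * m) \<le> \<dots> / (8 * m)"
      using card_edges_pos by (intro divide_right_mono) auto
    then show ?thesis by (simp add: stationary_def)
  qed
  have "(\<Sum>y\<in>V. stationary H y * (\<Sum>x\<in>V. lazy_walk H y x * (h x * ln (h x))))
      = (\<Sum>y\<in>V. \<Sum>x\<in>V. stationary H y * lazy_walk H y x * (h x * ln (h x)))"
    by (simp add: sum_distrib_left mult.assoc)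
  also have "\<dots> = (\<Sum>x\<in>V. \<Sum>y\<in>V. stationary H y * lazy_walk H y x * (h x * ln (h x)))"
    by (rule sum.swap)
  also have "\<dots> = entropy h"
    unfolding entropy_def by (intro sum.cong refl) (simp add: stationary_step flip: sum_distrib_right)
  finally have ent: "(\<Sum>y\<in>V. stationary H y * (\<Sum>x\<in>V. lazy_walk H y x * (h x * ln (h x)))) = entropy h" .
  have "(\<Sum>y\<in>V. \<Sum>x\<in>V. adj y x * (sqrt (h y) - sqrt (h x))\<^sup>2) / (8 * m)
      \<le> (\<Sum>y\<in>V. stationary H y * ((\<Sum>x\<in>V. lazy_walk H y x * (h x * ln (h x))) - g y * ln (g y)))"
    by (subst sum_divide_distrib) (intro sum_mono loc)
  also have "\<dots> = entropy h - entropy g"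
    unfolding ent[symmetric] by (simp add: entropy_def right_diff_distrib sum_subtractf)
  finally show ?thesis unfolding g_def[abs_def] .
qed

lemma entropy_density_nonneg:
  assumes "u \<in> V"
  shows "entropy (density u t) \<ge> 0"
proof -
  have "h - 1 \<le> h * ln h" if "h \<ge> 0" for h :: real
  proof (cases "h = 0")
    case False
    then have "h * (1 - 1 / h) \<le> h * ln h"
      using that ln_le_minus_one[of "1 / h"] by (intro mult_left_mono) (auto simp: ln_div)
    then show ?thesis using False by (simp add: right_diff_distrib)
  qed simp
  then have "(\<Sum>x\<in>V. stationary H x * (density u t x - 1)) \<le> entropy (density u t)"
    unfolding entropy_def using stationary_pos
    by (intro sum_mono mult_left_mono) (auto simp: density_nonneg less_imp_le)
  moreover have "(\<Sum>x\<in>V. stationary H x * (density u t x - 1)) = 0"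
    using sum_density[OF assms] sum_stationary by (simp add: right_diff_distrib sum_subtractf)
  ultimately show ?thesis by simp
qed

lemma entropy_density_0:
  assumes "u \<in> V"
  shows "entropy (density u 0) \<le> ln (2 * m)"
proof -
  have "entropy (density u 0) = (\<Sum>x\<in>V. if x = u then ln (1 / stationary H u) else 0)"
    unfolding entropy_def using stationary_pos
    by (intro sum.cong refl) (auto simp: density_0 less_imp_neq[symmetric])
  also have "\<dots> = ln (1 / stationary H u)" using assms finite_verts by simp
  also have "\<dots> \<le> ln (2 * m)"
  proof (rule ln_mono)
    show "1 / stationary H u \<le> 2 * m"
      using stationary_ge[OF assms] stationary_pos[OF assms] card_edges_pos by (simp add: field_simps)
  qed (use stationary_pos[OF assms] in simp)
  finally show ?thesis .
qed

definition energy :: "'a \<Rightarrow> nat \<Rightarrow> real" where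
  "energy u t = (\<Sum>x\<in>V. \<Sum>y\<in>V. adj x y * (sqrt (density u t x) - sqrt (density u t y))\<^sup>2)"

text \<open>The entropy losses telescope, so the budget does not grow with \<open>T\<close>.\<close>

lemma sum_energy_le:
  assumes "u \<in> V"
  shows "(\<Sum>t<T. energy u t) \<le> 8 * m * ln (2 * m)"
proof -
  have "energy u t / (8 * m) \<le> entropy (density u t) - entropy (density u (Suc t))" for t
  proof -
    have "entropy (density u (Suc t)) = entropy (\<lambda>y. \<Sum>x\<in>V. lazy_walk H y x * density u t x)"
      unfolding entropy_def by (intro sum.cong refl) (simp add: density_Suc)
    then show ?thesis
      using entropy_step[of "density u t"] density_nonneg by (simp add: energy_def)
  qed
  then have "(\<Sum>t<T. energy u t / (8 * m)) \<le> (\<Sum>t<T. entropy (density u t) - entropy (density u (Suc t)))"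
    by (intro sum_mono)
  also have "\<dots> = entropy (density u 0) - entropy (density u T)"
    by (rule sum_lessThan_telescope')
  also have "\<dots> \<le> ln (2 * m)"
    using entropy_density_0[OF assms] entropy_density_nonneg[OF assms, of T] by linarith
  finally show ?thesis using card_edges_pos by (simp add: field_simps flip: sum_divide_distrib)
qed

text \<open>Pigeonhole over time, applied after averaging over \<open>u\<close>: the mixing time
  asks for one \<open>t\<close> that serves all starts together.\<close>

lemma low_energy_time:
  assumes "T > 0"
  shows "\<exists>t<T. (\<Sum>u\<in>V. stationary H u * energy u t) \<le> 8 * m * ln (2 * m) / real T"
proof (rule ccontr)
  assume "\<not> ?thesis"
  then have "(\<Sum>t<T. 8 * m * ln (2 * m) / real T) < (\<Sum>t<T. \<Sum>u\<in>V. stationary H u * energy u t)"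
    using assms by (intro sum_strict_mono) (auto simp: not_le)
  also have "\<dots> = (\<Sum>u\<in>V. stationary H u * (\<Sum>t<T. energy u t))"
    by (subst sum.swap) (simp add: sum_distrib_left)
  also have "\<dots> \<le> (\<Sum>u\<in>V. stationary H u * (8 * m * ln (2 * m)))"
    using stationary_pos by (intro sum_mono mult_left_mono sum_energy_le) (auto simp: less_imp_le)
  also have "\<dots> = 8 * m * ln (2 * m)"
    using sum_stationary by (simp flip: sum_distrib_right)
  finally show False using assms by simp
qed

text \<open>Averaged over \<open>y\<close> with the stationary weights,
  \<open>(F u y)\<^sup>2\<close> equals \<open>stationary H u\<close>. So the deviation of the walk
  from equilibrium at \<open>x\<close> is an average of differences
  \<open>(F u x)\<^sup>2 - (F u y)\<^sup>2\<close>, and these are small in total when the unit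
  vectors \<open>F x\<close> and \<open>F y\<close> are close.\<close>

lemma sum_tv_dist_le:
  assumes W: "(\<Sum>x\<in>V. \<Sum>y\<in>V. stationary H x * stationary H y *
      (\<Sum>u\<in>V. (F u x - F u y)\<^sup>2)) \<le> \<omega>\<^sup>2" and "\<omega> > 0"
    and F: "\<And>u x. F u x = sqrt (stationary H u) * sqrt (density u t x)"
  shows "(\<Sum>u\<in>V. stationary H u * tv_dist V (walk_dist H u t) (stationary H)) \<le> \<omega>"
proof -
  let ?p = "stationary H"
  have F2: "(F u x)\<^sup>2 = ?p u * density u t x" if "u \<in> V" "x \<in> V" for u x
    using stationary_pos[OF that(1)] density_nonneg[OF that(2)] by (simp add: F power_mult_distrib)
  have F1: "(\<Sum>u\<in>V. (F u x)\<^sup>2) = 1" if "x \<in> V" for x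
    using sum_density_start[OF that, of t] that by (simp add: F2 cong: sum.cong)
  have tv: "?p u * \<bar>walk_dist H u t x - ?p x\<bar> \<le> (\<Sum>y\<in>V. ?p x * ?p y * \<bar>(F u x)\<^sup>2 - (F u y)\<^sup>2\<bar>)"
    if u: "u \<in> V" and x: "x \<in> V" for u x
  proof -
    have "?p u * (walk_dist H u t x - ?p x) = ?p x * ((F u x)\<^sup>2 - ?p u)"
      using stationary_pos[OF x] by (simp add: F2[OF u x] density_def right_diff_distrib)
    also have "(F u x)\<^sup>2 - ?p u = (\<Sum>y\<in>V. ?p y * ((F u x)\<^sup>2 - (F u y)\<^sup>2))"
    proof -
      have "(\<Sum>y\<in>V. ?p y * (F u y)\<^sup>2) = (\<Sum>y\<in>V. ?p u * (?p y * density u t y))"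
        by (intro sum.cong refl) (simp add: F2[OF u])
      also have "\<dots> = ?p u"
        using sum_density[OF u, of t] by (simp flip: sum_distrib_left)
      finally have y: "(\<Sum>y\<in>V. ?p y * (F u y)\<^sup>2) = ?p u" .
      have "(\<Sum>y\<in>V. ?p y * ((F u x)\<^sup>2 - (F u y)\<^sup>2)) = (\<Sum>y\<in>V. ?p y) * (F u x)\<^sup>2 - (\<Sum>y\<in>V. ?p y * (F u y)\<^sup>2)"
        by (simp only: right_diff_distrib sum_subtractf sum_distrib_right)
      then show ?thesis by (simp add: y sum_stationary)
    qed
    finally have "?p u * (walk_dist H u t x - ?p x) = (\<Sum>y\<in>V. ?p x * ?p y * ((F u x)\<^sup>2 - (F u y)\<^sup>2))"
      by (simp add: sum_distrib_left mult.assoc)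
    then have "\<bar>?p u * (walk_dist H u t x - ?p x)\<bar> \<le> (\<Sum>y\<in>V. \<bar>?p x * ?p y * ((F u x)\<^sup>2 - (F u y)\<^sup>2)\<bar>)"
      by (simp only: sum_abs)
    also have "\<dots> = (\<Sum>y\<in>V. ?p x * ?p y * \<bar>(F u x)\<^sup>2 - (F u y)\<^sup>2\<bar>)"
      using stationary_pos x by (intro sum.cong refl) (simp add: abs_mult less_imp_le)
    finally show ?thesis using stationary_pos[OF u] by (simp add: abs_mult)
  qed
  have pair: "(\<Sum>u\<in>V. \<bar>(F u x)\<^sup>2 - (F u y)\<^sup>2\<bar>) \<le> (\<Sum>u\<in>V. (F u x - F u y)\<^sup>2) / \<omega> + \<omega>"
    if x: "x \<in> V" and y: "y \<in> V" for x y
  proof -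
    \<comment> \<open>Weighted AM-GM for \<open>(a - b) * (a + b)\<close>. The sum part is bounded
      by the unit norms and costs \<open>\<omega>\<close>; the difference part costs
      \<open>\<omega>\<^sup>2 / \<omega>\<close>; the factor \<open>1 / 2\<close> in
      \<open>tv_dist\<close> brings the total \<open>2 * \<omega>\<close> down to
      \<open>\<omega>\<close>.\<close>
    have "\<bar>a\<^sup>2 - b\<^sup>2\<bar> \<le> (a - b)\<^sup>2 / \<omega> + \<omega> / 2 * (a\<^sup>2 + b\<^sup>2)" for a b :: real
    proof -
      have "\<bar>a\<^sup>2 - b\<^sup>2\<bar> = \<bar>(a - b) * (a + b)\<bar>" by (simp add: power2_eq_square algebra_simps)
      also have "\<dots> \<le> (a - b)\<^sup>2 / \<omega> + \<omega> / 4 * (a + b)\<^sup>2"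
      proof -
        have "\<bar>p * q\<bar> \<le> p\<^sup>2 / \<omega> + \<omega> / 4 * q\<^sup>2" for p q :: real
        proof -
          have "0 \<le> (\<bar>p\<bar> - \<omega> / 2 * \<bar>q\<bar>)\<^sup>2 / \<omega>" using \<open>\<omega> > 0\<close> by simp
          also have "\<dots> = p\<^sup>2 / \<omega> + \<omega> / 4 * q\<^sup>2 - \<bar>p\<bar> * \<bar>q\<bar>"
            using \<open>\<omega> > 0\<close> by (simp add: power2_diff power_mult_distrib power2_eq_square[of \<omega>] field_simps)
          finally show ?thesis by (simp add: abs_mult)
        qed
        then show ?thesis .
      qed
      also have "(a + b)\<^sup>2 \<le> 2 * (a\<^sup>2 + b\<^sup>2)"
        using zero_le_power2[of "a - b"] by (simp add: power2_eq_square algebra_simps)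
      finally show ?thesis using \<open>\<omega> > 0\<close> by (simp add: algebra_simps)
    qed
    then have "(\<Sum>u\<in>V. \<bar>(F u x)\<^sup>2 - (F u y)\<^sup>2\<bar>)
        \<le> (\<Sum>u\<in>V. (F u x - F u y)\<^sup>2 / \<omega> + \<omega> / 2 * ((F u x)\<^sup>2 + (F u y)\<^sup>2))"
      by (intro sum_mono)
    also have "\<dots> = (\<Sum>u\<in>V. (F u x - F u y)\<^sup>2) / \<omega>
        + \<omega> / 2 * ((\<Sum>u\<in>V. (F u x)\<^sup>2) + (\<Sum>u\<in>V. (F u y)\<^sup>2))"
      by (simp only: sum.distrib sum_divide_distrib sum_distrib_left distrib_left)
    finally show ?thesis by (simp add: F1 x y)
  qed
  have "2 * (\<Sum>u\<in>V. ?p u * tv_dist V (walk_dist H u t) ?p)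
      = (\<Sum>u\<in>V. \<Sum>x\<in>V. ?p u * \<bar>walk_dist H u t x - ?p x\<bar>)"
    by (simp add: tv_dist_def sum_distrib_left)
  also have "\<dots> \<le> (\<Sum>u\<in>V. \<Sum>x\<in>V. \<Sum>y\<in>V. ?p x * ?p y * \<bar>(F u x)\<^sup>2 - (F u y)\<^sup>2\<bar>)"
    by (intro sum_mono tv)
  also have "\<dots> = (\<Sum>x\<in>V. \<Sum>y\<in>V. ?p x * ?p y * (\<Sum>u\<in>V. \<bar>(F u x)\<^sup>2 - (F u y)\<^sup>2\<bar>))"
    by (subst sum_rotate3) (simp only: sum_distrib_left)
  also have "\<dots> \<le> (\<Sum>x\<in>V. \<Sum>y\<in>V. ?p x * ?p y * ((\<Sum>u\<in>V. (F u x - F u y)\<^sup>2) / \<omega> + \<omega>))"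
    using stationary_pos by (intro sum_mono mult_left_mono pair) (auto simp: less_imp_le)
  also have "\<dots> = (\<Sum>x\<in>V. \<Sum>y\<in>V. ?p x * ?p y * (\<Sum>u\<in>V. (F u x - F u y)\<^sup>2)) * (1 / \<omega>)
      + (\<Sum>x\<in>V. \<Sum>y\<in>V. ?p x * ?p y) * \<omega>"
    unfolding sum_distrib_right sum.distrib[symmetric]
    by (intro sum.cong refl) (simp add: distrib_left)
  also have "(\<Sum>x\<in>V. \<Sum>y\<in>V. ?p x * ?p y) = 1"
    using sum_product[of ?p V ?p V] sum_stationary by simp
  also have "(\<Sum>x\<in>V. \<Sum>y\<in>V. ?p x * ?p y * (\<Sum>u\<in>V. (F u x - F u y)\<^sup>2)) * (1 / \<omega>) \<le> \<omega>\<^sup>2 * (1 / \<omega>)"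
    using W \<open>\<omega> > 0\<close> by (intro mult_right_mono) auto
  also have "\<omega>\<^sup>2 * (1 / \<omega>) = \<omega>" using \<open>\<omega> > 0\<close> by (simp add: power2_eq_square)
  finally show ?thesis by simp
qed

text \<open>\<open>sphere_weak_poincare\<close> with edge weight \<open>adj x y / (c * m)\<close>.
  Both the energy bound and the number of adjacent pairs are proportional to \<open>m\<close>, so
  the size of the graph survives only in \<open>ln (2 * m) / T\<close>.\<close>

lemma exists_mixed_time:
  assumes cut: "\<And>S. S \<subseteq> V \<Longrightarrow> sum (stationary H) S * sum (stationary H) (V - S)
      \<le> \<eta> + (\<Sum>x\<in>S. \<Sum>y\<in>V - S. adj x y) / (c * m)"
    and c: "c > 0" and T: "T > 0" and M: "M > 0" and \<alpha>: "\<alpha> > 0" and \<omega>: "\<omega> > 0"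
    and bound: "8 * M * (2 * M * \<eta> + (4 * \<alpha> * (ln (2 * m) / real T) / c + 1 / (\<alpha> * c))) + 24 / M\<^sup>2 \<le> \<omega>\<^sup>2"
  shows "\<exists>t<T. (\<Sum>u\<in>V. stationary H u * tv_dist V (walk_dist H u t) (stationary H)) \<le> \<omega>"
proof -
  let ?p = "stationary H"
  obtain t where t: "t < T" and en: "(\<Sum>u\<in>V. ?p u * energy u t) \<le> 8 * m * ln (2 * m) / real T"
    using low_energy_time[OF T] by blast
  define F where "F u x = sqrt (?p u) * sqrt (density u t x)" for u x
  define S where "S x y = (\<Sum>u\<in>V. (F u x - F u y)\<^sup>2)" for x y
  note mp = card_edges_pos
  have adjS: "(\<Sum>x\<in>V. \<Sum>y\<in>V. adj x y * S x y) \<le> 8 * m * ln (2 * m) / real T"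
  proof -
    have "(F u x - F u y)\<^sup>2 = ?p u * (sqrt (density u t x) - sqrt (density u t y))\<^sup>2" if "u \<in> V" for u x y
      using stationary_pos[OF that] unfolding F_def right_diff_distrib[symmetric] power_mult_distrib by simp
    then have "(\<Sum>x\<in>V. \<Sum>y\<in>V. adj x y * S x y)
        = (\<Sum>x\<in>V. \<Sum>y\<in>V. \<Sum>u\<in>V. ?p u * (adj x y * (sqrt (density u t x) - sqrt (density u t y))\<^sup>2))"
      unfolding S_def sum_distrib_left by (intro sum.cong refl) (simp add: mult.left_commute)
    also have "\<dots> = (\<Sum>u\<in>V. ?p u * energy u t)"
      unfolding energy_def sum_distrib_left by (rule sum_rotate3[symmetric])
    finally show ?thesis using en by simp
  qed
  have adj1: "(\<Sum>x\<in>V. \<Sum>y\<in>V. adj x y) = 2 * m"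
    using sum_degree by (simp add: sum_adj)
  have "(\<Sum>x\<in>V. \<Sum>y\<in>V. adj x y / (c * m) * (\<alpha> / 2 * S x y + 1 / (2 * \<alpha>)))
      = (\<Sum>x\<in>V. \<Sum>y\<in>V. adj x y * S x y) * (\<alpha> / (2 * c * m))
        + (\<Sum>x\<in>V. \<Sum>y\<in>V. adj x y) * (1 / (2 * \<alpha> * c * m))"
    unfolding sum_distrib_right sum.distrib[symmetric]
    by (intro sum.cong refl) (simp add: distrib_left mult_ac)
  also have "\<dots> \<le> 8 * m * ln (2 * m) / real T * (\<alpha> / (2 * c * m)) + 2 * m * (1 / (2 * \<alpha> * c * m))"
    unfolding adj1 using adjS c \<alpha> mp by (intro add_mono mult_right_mono) auto
  also have "\<dots> = 4 * \<alpha> * (ln (2 * m) / real T) / c + 1 / (\<alpha> * c)"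
    using mp c \<alpha> by (simp add: mult_ac)
  finally have Q: "(\<Sum>x\<in>V. \<Sum>y\<in>V. adj x y / (c * m) * (\<alpha> / 2 * S x y + 1 / (2 * \<alpha>))) \<le> \<dots>" .
  have "(\<Sum>x\<in>V. \<Sum>y\<in>V. ?p x * ?p y * S x y)
      \<le> 8 * M * (2 * M * \<eta> + (\<Sum>x\<in>V. \<Sum>y\<in>V. adj x y / (c * m) * (\<alpha> / 2 * S x y + 1 / (2 * \<alpha>)))) + 24 / M\<^sup>2"
    unfolding S_def
  proof (rule sphere_weak_poincare[OF finite_verts finite_verts _ sum_stationary _ _ _ M \<alpha>])
    show "(\<Sum>u\<in>V. (F u x)\<^sup>2) = 1" if "x \<in> V" for x
    proof -
      have "(\<Sum>u\<in>V. (F u x)\<^sup>2) = (\<Sum>u\<in>V. ?p u * density u t x)"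
        using stationary_pos density_nonneg[OF that]
        by (intro sum.cong refl) (simp add: F_def power_mult_distrib less_imp_le)
      then show ?thesis using sum_density_start[OF that] by simp
    qed
  next
    fix S assume "S \<subseteq> V"
    then show "sum ?p S * sum ?p (V - S) \<le> \<eta> + (\<Sum>x\<in>S. \<Sum>y\<in>V - S. adj x y / (c * m))"
      using cut[of S] by (simp add: sum_divide_distrib)
  qed (use stationary_pos adj_nonneg c in \<open>auto simp: less_imp_le\<close>)
  also have "\<dots> \<le> 8 * M * (2 * M * \<eta> + (4 * \<alpha> * (ln (2 * m) / real T) / c + 1 / (\<alpha> * c))) + 24 / M\<^sup>2"
    using M by (intro add_right_mono mult_left_mono add_left_mono Q) auto
  also have "\<dots> \<le> \<omega>\<^sup>2" by (rule bound)
  finally have "(\<Sum>u\<in>V. ?p u * tv_dist V (walk_dist H u t) ?p) \<le> \<omega>"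
    using \<omega> by (intro sum_tv_dist_le[of F]) (simp_all add: S_def F_def)
  then show ?thesis using t by blast
qed

text \<open>Since \<open>stationary H u \<ge> 1 / (2 * m)\<close> and
  \<open>m \<le> K * card V\<close>, a uniform average is at most \<open>2 * K\<close> times a
  stationary one; hence \<open>\<omega>\<close>. The other constants settle the hypothesis
  \<open>bound\<close> of \<open>exists_mixed_time\<close> term by term: \<open>M\<close> makes the
  clipping term \<open>24 / 100 * \<omega>\<^sup>2\<close>, and \<open>\<eta>\<close>,
  \<open>\<alpha>\<close>, \<open>C\<close> make each of the other three at most a quarter of
  \<open>\<omega>\<^sup>2\<close>.\<close>

lemma avg_mixing_time_le:
  fixes K c \<epsilon> \<eta> \<omega> M \<alpha> C :: real
  assumes \<epsilon>: "\<epsilon> > 0" and K: "K > 0" and c: "c > 0" and n: "card V \<ge> 2"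
    and few: "m \<le> K * real (card V)"
    and cut: "\<And>S. S \<subseteq> V \<Longrightarrow> sum (stationary H) S * sum (stationary H) (V - S)
      \<le> \<eta> + (\<Sum>x\<in>S. \<Sum>y\<in>V - S. adj x y) / (c * m)"
    and \<omega>: "\<omega> = \<epsilon> / (2 * K)" and M: "M = 10 / \<omega>" and \<eta>: "\<eta> = \<omega>\<^sup>2 / (64 * M\<^sup>2)"
    and \<alpha>: "\<alpha> = 32 * M / (c * \<omega>\<^sup>2)" and C: "C = 256 * M * \<alpha> / (c * \<omega>\<^sup>2)"
  shows "ereal_of_enat (avg_mixing_time H \<epsilon>) \<le> ereal (C * ln (real (card V)))"
proof -
  define N where "N = real (card V)"
  have N: "N \<ge> 2" using n by (simp add: N_def)
  have pos: "\<omega> > 0" "M > 0" "\<alpha> > 0" "C > 0"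
  proof -
    show 1: "\<omega> > 0" using \<epsilon> K \<omega> by simp
    then show 2: "M > 0" using M by simp
    with 1 show 3: "\<alpha> > 0" using c \<alpha> by simp
    with 1 2 show "C > 0" using c C by simp
  qed
  define T where "T = nat \<lceil>C * ln N\<rceil>"
  have lnN: "ln N > 0" using N by simp
  then have CN: "C * ln N > 0" using pos by simp
  then have T: "T > 0" by (simp add: T_def)
  have TC: "C * ln N \<le> real T" unfolding T_def by linarith
  have "2 * m \<le> N\<^sup>2"
  proof -
    have "edges H \<subseteq> {e. e \<subseteq> V \<and> card e = 2}" using edge_pair by auto
    then have "card (edges H) \<le> card {e. e \<subseteq> V \<and> card e = 2}"
      using finite_verts by (intro card_mono) auto
    also have "\<dots> = card V choose 2" by (rule n_subsets[OF finite_verts])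
    also have "2 * (card V choose 2) \<le> card V * (card V - 1)"
      unfolding choose_two by simp
    also have "\<dots> \<le> card V * card V" by simp
    finally have "2 * card (edges H) \<le> card V * card V" by simp
    then have "real (2 * card (edges H)) \<le> real (card V * card V)" by (simp only: of_nat_le_iff)
    then show ?thesis by (simp add: N_def power2_eq_square)
  qed
  then have "ln (2 * m) \<le> ln (N\<^sup>2)" using card_edges_pos by (intro ln_mono) auto
  also have "\<dots> = 2 * ln N" using N by (simp add: ln_realpow)
  finally have "ln (2 * m) / real T \<le> 2 * ln N / (C * ln N)"
    using CN TC lnN T by (intro frac_le) auto
  also have "\<dots> = 2 / C" using lnN by simp
  finally have lnT: "ln (2 * m) / real T \<le> 2 / C" .
  have "8 * M * (2 * M * \<eta> + (4 * \<alpha> * (ln (2 * m) / real T) / c + 1 / (\<alpha> * c))) + 24 / M\<^sup>2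
      \<le> 8 * M * (2 * M * \<eta> + (4 * \<alpha> * (2 / C) / c + 1 / (\<alpha> * c))) + 24 / M\<^sup>2"
    using pos c lnT by (intro add_right_mono mult_left_mono add_left_mono divide_right_mono) auto
  also have "\<dots> = 16 * M\<^sup>2 * \<eta> + 64 * M * \<alpha> / (c * C) + 8 * M / (\<alpha> * c) + 24 / M\<^sup>2"
    by (simp add: distrib_left power2_eq_square mult_ac)
  also have "16 * M\<^sup>2 * \<eta> = \<omega>\<^sup>2 / 4" using pos by (simp add: \<eta>)
  also have "64 * M * \<alpha> / (c * C) = \<omega>\<^sup>2 / 4" using pos(1-3) c by (simp add: C)
  also have "8 * M / (\<alpha> * c) = \<omega>\<^sup>2 / 4" using pos(1,2) c by (simp add: \<alpha>)
  finally have sum: "8 * M * (2 * M * \<eta> + (4 * \<alpha> * (ln (2 * m) / real T) / c + 1 / (\<alpha> * c))) + 24 / M\<^sup>2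
      \<le> \<omega>\<^sup>2 / 4 + \<omega>\<^sup>2 / 4 + \<omega>\<^sup>2 / 4 + 24 / M\<^sup>2" .
  have "24 / M\<^sup>2 = 24 / 100 * \<omega>\<^sup>2" using pos by (simp add: M power_divide)
  with sum have "8 * M * (2 * M * \<eta> + (4 * \<alpha> * (ln (2 * m) / real T) / c + 1 / (\<alpha> * c))) + 24 / M\<^sup>2 \<le> \<omega>\<^sup>2"
    using zero_le_power2[of \<omega>] by linarith
  from exists_mixed_time[OF cut c T pos(2,3,1) this]
  obtain t where t: "t < T"
    and mixed: "(\<Sum>u\<in>V. stationary H u * tv_dist V (walk_dist H u t) (stationary H)) \<le> \<omega>"
    by blast
  have "1 / N * (\<Sum>u\<in>V. tv_dist V (walk_dist H u t) (stationary H))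
      \<le> (\<Sum>u\<in>V. 2 * K * (stationary H u * tv_dist V (walk_dist H u t) (stationary H)))"
    unfolding sum_distrib_left
  proof (intro sum_mono)
    fix u assume u: "u \<in> V"
    have "1 / N = 2 * m / N * (1 / (2 * m))" using card_edges_pos by simp
    also have "\<dots> \<le> (2 * K) * stationary H u"
    proof (rule mult_mono)
      show "2 * m / N \<le> 2 * K" using few N by (simp add: N_def pos_divide_le_eq)
    qed (use stationary_ge[OF u] K in auto)
    finally have "1 / N \<le> 2 * K * stationary H u" .
    moreover have "tv_dist V (walk_dist H u t) (stationary H) \<ge> 0"
      by (simp add: tv_dist_def sum_nonneg)
    ultimately have "1 / N * tv_dist V (walk_dist H u t) (stationary H)
        \<le> 2 * K * stationary H u * tv_dist V (walk_dist H u t) (stationary H)"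
      by (rule mult_right_mono)
    then show "1 / N * tv_dist V (walk_dist H u t) (stationary H)
        \<le> 2 * K * (stationary H u * tv_dist V (walk_dist H u t) (stationary H))"
      by (simp only: mult.assoc)
  qed
  also have "\<dots> \<le> 2 * K * \<omega>"
    unfolding sum_distrib_left[symmetric] using mixed K by (intro mult_left_mono) auto
  also have "\<dots> = \<epsilon>" using K by (simp add: \<omega>)
  finally have "avg_mixing_time H \<epsilon> \<le> enat t"
    unfolding avg_mixing_time_def N_def by (intro INF_lower) simp
  then have "ereal_of_enat (avg_mixing_time H \<epsilon>) \<le> ereal (real t)"
    by (metis ereal_of_enat_le_iff ereal_of_enat_simps(1))
  \<comment> \<open>The strict \<open>t < T\<close> absorbs the ceiling in \<open>T\<close>, so
    rounding costs nothing.\<close>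
  also have "real t \<le> C * ln N"
    using t unfolding T_def by linarith
  finally show ?thesis by (simp add: N_def)
qed

end

section \<open>Isoperimetry of the random graph\<close>

lemma vertex_pairs_E:
  assumes "e \<in> vertex_pairs n"
  obtains x y where "e = {x, y}" "x \<noteq> y" "x < n" "y < n"
  using assms by (auto simp: vertex_pairs_def card_2_iff)

lemma doubleton_vertex_pairs: "{x, y} \<in> vertex_pairs n \<longleftrightarrow> x \<noteq> y \<and> x < n \<and> y < n"
  by (auto simp: vertex_pairs_def card_2_iff doubleton_eq_iff)

lemma finite_vertex_pairs: "finite (vertex_pairs n)"
  by (rule finite_subset[of _ "Pow {..<n}"]) (auto simp: vertex_pairs_def)

lemma finite_ring_edges: "finite (ring_edges n k)"
  by (rule finite_subset[OF _ finite_vertex_pairs[of n]]) (auto simp: ring_edges_def)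

lemma card_ring_edges_le: "card (ring_edges n k) \<le> n * k"
proof -
  have "ring_edges n k \<subseteq> (\<lambda>(i, d). {i, (i + d) mod n}) ` ({..<n} \<times> {1..k})"
    by (auto simp: ring_edges_def)
  then have "card (ring_edges n k) \<le> card ({..<n} \<times> {1..k})"
    by (intro surj_card_le) auto
  then show ?thesis by simp
qed

lemma ring_degree_le: "card {e \<in> ring_edges n k. x \<in> e} \<le> 2 * k"
proof -
  \<comment> \<open>Forward and backward neighbours. A backward step by \<open>d\<close> is written
    as \<open>(n - 1) * d\<close> forward modulo \<open>n\<close>, avoiding truncated
    subtraction.\<close>
  let ?f = "\<lambda>d. {x, (x + d) mod n}" and ?g = "\<lambda>d. {x, (x + (n - 1) * d) mod n}"
  have "{e \<in> ring_edges n k. x \<in> e} \<subseteq> ?f ` {1..k} \<union> ?g ` {1..k}"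
  proof
    fix e assume "e \<in> {e \<in> ring_edges n k. x \<in> e}"
    then obtain i d where e: "e = {i, (i + d) mod n}" "i < n" "d \<in> {1..k}" "x \<in> e"
      by (auto simp: ring_edges_def)
    then consider "x = i" | "x = (i + d) mod n" by auto
    then show "e \<in> ?f ` {1..k} \<union> ?g ` {1..k}"
    proof cases
      case 2
      have "(x + (n - 1) * d) mod n = (i + d + (n - 1) * d) mod n"
        unfolding 2 by (simp add: mod_simps)
      also have "i + d + (n - 1) * d = i + n * d"
        using e(2) by (cases n) auto
      finally have "(x + (n - 1) * d) mod n = i" using e(2) by simp
      then have "e = ?g d" unfolding e(1) using 2 by auto
      then show ?thesis using e(3) by blast
    qed (use e in auto)
  qed
  then have "card {e \<in> ring_edges n k. x \<in> e} \<le> card (?f ` {1..k} \<union> ?g ` {1..k})"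
    by (intro card_mono) auto
  also have "\<dots> \<le> card (?f ` {1..k}) + card (?g ` {1..k})" by (rule card_Un_le)
  also have "\<dots> \<le> k + k"
    using card_image_le[of "{1..k}" ?f] card_image_le[of "{1..k}" ?g] by (intro add_mono) auto
  finally show ?thesis by simp
qed

lemma Suc_ring_edge:
  assumes "Suc i < n" "k \<ge> 1"
  shows "{i, Suc i} \<in> ring_edges n k"
proof -
  have "{i, Suc i} = {i, (i + 1) mod n}" using assms by simp
  moreover have "{i, Suc i} \<in> vertex_pairs n" using assms by (simp add: doubleton_vertex_pairs)
  ultimately show ?thesis unfolding ring_edges_def using assms Suc_lessD by blast
qed

lemma ex_ring_edge:
  assumes "i < n" "n \<ge> 2" "k \<ge> 1"
  shows "\<exists>e\<in>ring_edges n k. i \<in> e"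
proof (cases "Suc i < n")
  case True
  then show ?thesis using Suc_ring_edge[OF True assms(3)] by auto
next
  case False
  then obtain j where j: "i = Suc j" using assms by (cases i) auto
  then show ?thesis using Suc_ring_edge[of j n k] assms by auto
qed

definition crosses :: "nat set \<Rightarrow> nat set \<Rightarrow> bool" where
  "crosses S e \<longleftrightarrow> e \<inter> S \<noteq> {} \<and> \<not> e \<subseteq> S"

text \<open>Only the edges from \<open>i\<close> to \<open>Suc i\<close> are recorded, without
  wrap-around or longer ring edges. Then membership of 0 and an arbitrary boundary determine
  \<open>S\<close>, which gives the exact count in \<open>sum_path_boundary\<close>.\<close>

definition path_boundary :: "nat \<Rightarrow> nat set \<Rightarrow> nat set" where
  "path_boundary n S = {i. Suc i < n \<and> (i \<in> S) \<noteq> (Suc i \<in> S)}"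

lemma finite_path_boundary: "finite (path_boundary n S)"
  by (rule finite_subset[of _ "{..<n}"]) (auto simp: path_boundary_def)

lemma card_path_boundary_le:
  assumes "k \<ge> 1"
  shows "card (path_boundary n S) \<le> card {e \<in> ring_edges n k. crosses S e}"
proof (rule card_inj_on_le)
  show "inj_on (\<lambda>i. {i, Suc i}) (path_boundary n S)"
    by (auto simp: inj_on_def doubleton_eq_iff)
  show "(\<lambda>i. {i, Suc i}) ` path_boundary n S \<subseteq> {e \<in> ring_edges n k. crosses S e}"
    using Suc_ring_edge[OF _ assms] by (auto simp: path_boundary_def crosses_def)
qed (use finite_ring_edges in auto)

text \<open>Generating function of the boundary size. When a new last vertex is added, exactly one
  of the choices in or out creates a boundary edge, hence a factor \<open>1 + q\<close>.\<close>

lemma sum_path_boundary: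
  fixes q :: real
  shows "(\<Sum>S\<in>Pow {..<Suc n}. q ^ card (path_boundary (Suc n) S)) = 2 * (1 + q) ^ n"
proof (induction n)
  case 0
  have "path_boundary (Suc 0) S = {}" for S by (simp add: path_boundary_def)
  then show ?case by (simp add: card_Pow)
next
  case (Suc n)
  have ins: "{..<Suc (Suc n)} = insert (Suc n) {..<Suc n}" by auto
  have pb: "q ^ card (path_boundary (Suc (Suc n)) S) + q ^ card (path_boundary (Suc (Suc n)) (insert (Suc n) S))
      = q ^ card (path_boundary (Suc n) S) * (1 + q)" if "S \<in> Pow {..<Suc n}" for S
  proof -
    have out: "Suc n \<notin> S" using that by auto
    have nin: "n \<notin> path_boundary (Suc n) S" by (simp add: path_boundary_def)
    have 1: "path_boundary (Suc (Suc n)) S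
        = (if n \<in> S then insert n (path_boundary (Suc n) S) else path_boundary (Suc n) S)"
      using out by (auto simp: path_boundary_def less_Suc_eq)
    have 2: "path_boundary (Suc (Suc n)) (insert (Suc n) S)
        = (if n \<in> S then path_boundary (Suc n) S else insert n (path_boundary (Suc n) S))"
      using out by (auto simp: path_boundary_def less_Suc_eq)
    show ?thesis unfolding 1 2 using nin
      by (simp add: finite_path_boundary algebra_simps)
  qed
  have "(\<Sum>S\<in>Pow {..<Suc (Suc n)}. q ^ card (path_boundary (Suc (Suc n)) S))
      = (\<Sum>S\<in>Pow {..<Suc n}. q ^ card (path_boundary (Suc (Suc n)) S)
          + q ^ card (path_boundary (Suc (Suc n)) (insert (Suc n) S)))"
    unfolding ins by (rule sum_Pow_insert) auto
  also have "\<dots> = (\<Sum>S\<in>Pow {..<Suc n}. q ^ card (path_boundary (Suc n) S) * (1 + q))"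
    by (intro sum.cong refl pb)
  also have "\<dots> = 2 * (1 + q) ^ Suc n"
    unfolding sum_distrib_right[symmetric] Suc.IH by simp
  finally show ?case .
qed

lemma card_crossing_pairs_ge:
  assumes "S \<subseteq> {..<n}"
  shows "card S * (n - card S) \<le> card {e \<in> vertex_pairs n. crosses S e}"
proof -
  have "card (S \<times> ({..<n} - S)) \<le> card {e \<in> vertex_pairs n. crosses S e}"
  proof (rule card_inj_on_le)
    show "inj_on (\<lambda>(x, y). {x, y}) (S \<times> ({..<n} - S))"
      by (auto simp: inj_on_def doubleton_eq_iff)
    show "(\<lambda>(x, y). {x, y}) ` (S \<times> ({..<n} - S)) \<subseteq> {e \<in> vertex_pairs n. crosses S e}"
      using assms by (auto simp: doubleton_vertex_pairs crosses_def)
  qed (use finite_vertex_pairs in auto)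
  then show ?thesis
    using assms by (simp add: card_cartesian_product card_Diff_subset finite_subset[OF assms])
qed

lemma card_vertex_pairs_meeting_le:
  assumes "S \<subseteq> {..<n}"
  shows "card {e \<in> vertex_pairs n. e \<inter> S \<noteq> {}} \<le> card S * n"
proof -
  have "{e \<in> vertex_pairs n. e \<inter> S \<noteq> {}} \<subseteq> (\<lambda>(x, y). {x, y}) ` (S \<times> {..<n})"
  proof
    fix e assume "e \<in> {e \<in> vertex_pairs n. e \<inter> S \<noteq> {}}"
    then obtain x y where "e = {x, y}" "x < n" "y < n" "x \<in> S \<or> y \<in> S"
      by (auto elim!: vertex_pairs_E)
    then show "e \<in> (\<lambda>(x, y). {x, y}) ` (S \<times> {..<n})" by (auto simp: image_iff insert_commute)
  qed
  then have "card {e \<in> vertex_pairs n. e \<inter> S \<noteq> {}} \<le> card (S \<times> {..<n})"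
    using finite_subset[OF assms] by (intro surj_card_le) auto
  then show ?thesis by (simp add: card_cartesian_product)
qed

text \<open>Chernoff bound by the exponential moment. As \<open>s\<close> may have either sign, it
  covers upper tails as well as lower tails (\<open>s = - L\<close>).\<close>

lemma prob_bernoulli_count_le:
  fixes p r s :: real
  assumes A: "finite A" and T: "T \<subseteq> A" and p: "0 \<le> p" "p \<le> 1"
  shows "measure_pmf.prob (Pi_pmf A False (\<lambda>_. bernoulli_pmf p)) {X. r \<le> s * real (card {e \<in> T. X e})}
    \<le> exp (p * (exp s - 1) * real (card T) - r)"
proof -
  let ?M = "Pi_pmf A False (\<lambda>_. bernoulli_pmf p)"
  let ?u = "\<lambda>X. exp (s * real (card {e \<in> T. X e}))"
  have fT: "finite T" using finite_subset[OF T A] .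
  have "finite (set_pmf ?M)"
    by (simp add: set_Pi_pmf A) (rule finite_PiE_dflt, use A in auto)
  then have int: "integrable ?M ?u" by (rule integrable_measure_pmf_finite)
  have u: "?u X = (\<Prod>e\<in>A. if e \<in> T \<and> X e then exp s else 1)" for X
  proof -
    have "(\<Prod>e\<in>A. if e \<in> T \<and> X e then exp s else 1) = (\<Prod>e\<in>{e \<in> A. e \<in> T \<and> X e}. exp s)"
      by (rule prod.inter_filter[OF A, symmetric])
    also have "{e \<in> A. e \<in> T \<and> X e} = {e \<in> T. X e}" using T by auto
    finally show ?thesis by (simp add: exp_of_nat2_mult)
  qed
  have "measure_pmf.expectation ?M ?u
      = (\<Prod>e\<in>A. measure_pmf.expectation (bernoulli_pmf p) (\<lambda>v. if e \<in> T \<and> v then exp s else 1))"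
    unfolding u by (rule expectation_prod_Pi_pmf[OF A]) (auto intro: integrable_measure_pmf_finite)
  also have "\<dots> = (\<Prod>e\<in>A. if e \<in> T then 1 + p * (exp s - 1) else 1)"
    using p by (intro prod.cong refl) (auto simp: algebra_simps)
  also have "\<dots> = (1 + p * (exp s - 1)) ^ card T"
  proof -
    have "{e \<in> A. e \<in> T} = T" using T by auto
    then show ?thesis using A by (simp flip: prod.inter_filter)
  qed
  also have "\<dots> \<le> exp (p * (exp s - 1)) ^ card T"
  proof (rule power_mono)
    \<comment> \<open>For negative \<open>s\<close> the base is not visibly nonnegative; written as
      a convex combination it is.\<close>
    have "0 \<le> (1 - p) + p * exp s" using p by simp
    then show "0 \<le> 1 + p * (exp s - 1)" by (simp add: algebra_simps)
  qed (rule exp_ge_add_one_self)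
  finally have E: "measure_pmf.expectation ?M ?u \<le> exp (p * (exp s - 1) * real (card T))"
    by (simp add: exp_of_nat2_mult)
  have "measure_pmf.prob ?M {X. r \<le> s * real (card {e \<in> T. X e})} = measure_pmf.prob ?M {X \<in> space ?M. ?u X \<ge> exp r}"
    by simp
  also have "\<dots> \<le> measure_pmf.expectation ?M ?u / exp r"
    by (rule integral_Markov_inequality_measure[OF int, of UNIV]) auto
  also have "\<dots> \<le> exp (p * (exp s - 1) * real (card T)) / exp r"
    by (intro divide_right_mono E) auto
  finally show ?thesis by (simp add: exp_diff)
qed

section \<open>Three unlikely events for the random edges\<close>

abbreviation random_pairs :: "nat \<Rightarrow> nat \<Rightarrow> nat set set" where
  "random_pairs n k \<equiv> vertex_pairs n - ring_edges n k"

abbreviation edge_choice :: "nat \<Rightarrow> nat \<Rightarrow> real \<Rightarrow> (nat set \<Rightarrow> bool) pmf" where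
  "edge_choice n k \<delta> \<equiv> Pi_pmf (random_pairs n k) False (\<lambda>_. bernoulli_pmf (\<delta> / real n))"

text \<open>With tilt 1 and at most \<open>n * n\<close> pairs, \<open>exp 1 - 1 \<le> 2\<close>
  gives the exponent \<open>2 * \<delta> * n\<close>; the extra 1 in the threshold becomes the decay
  rate.\<close>

lemma prob_many_edges:
  assumes "n \<ge> 1" "\<delta> > 0" "\<delta> \<le> real n"
  shows "measure_pmf.prob (edge_choice n k \<delta>)
      {X. (2 * \<delta> + 1) * real n \<le> real (card {e \<in> random_pairs n k. X e})} \<le> exp (- real n)"
proof -
  have "random_pairs n k \<subseteq> {e \<in> vertex_pairs n. e \<inter> {..<n} \<noteq> {}}"
    by (auto simp: doubleton_vertex_pairs elim!: vertex_pairs_E)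
  then have "card (random_pairs n k) \<le> card {e \<in> vertex_pairs n. e \<inter> {..<n} \<noteq> {}}"
    by (intro card_mono) (auto simp: finite_vertex_pairs)
  also have "\<dots> \<le> card {..<n} * n" by (rule card_vertex_pairs_meeting_le) simp
  finally have "real (card (random_pairs n k)) \<le> real (card {..<n} * n)"
    by (simp only: of_nat_le_iff)
  then have "real (card (random_pairs n k)) \<le> real n * real n" by simp
  moreover have "exp 1 - 1 \<le> (2::real)" using exp_le by linarith
  ultimately have "\<delta> / real n * (exp 1 - 1) * real (card (random_pairs n k)) \<le> \<delta> / real n * 2 * (real n * real n)"
    using assms by (intro mult_mono) auto
  also have "\<dots> = 2 * \<delta> * real n" using assms by simp
  finally have le: "\<delta> / real n * (exp 1 - 1) * real (card (random_pairs n k)) - (2 * \<delta> + 1) * real n \<le> - real n"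
    by (simp add: algebra_simps)
  have "measure_pmf.prob (edge_choice n k \<delta>)
      {X. (2 * \<delta> + 1) * real n \<le> 1 * real (card {e \<in> random_pairs n k. X e})}
      \<le> exp (\<delta> / real n * (exp 1 - 1) * real (card (random_pairs n k)) - (2 * \<delta> + 1) * real n)"
    using assms by (intro prob_bernoulli_count_le) (auto simp: finite_vertex_pairs)
  also have "\<dots> \<le> exp (- real n)" using le by simp
  finally show ?thesis by simp
qed

text \<open>This prevents few vertices from carrying much stationary mass. The tilt
  \<open>3 / b\<close> turns \<open>b * n\<close> edges into \<open>exp (- 3 n)\<close>; the
  condition on \<open>\<gamma>\<close> lets the moment cost only \<open>exp n\<close>, and the union
  over at most \<open>2 ^ n\<close> sets costs another \<open>exp n\<close>.\<close>

lemma prob_heavy_small_set: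
  assumes "n \<ge> 1" "\<delta> > 0" "\<delta> \<le> real n" "b > 0" and \<gamma>: "\<delta> * (exp (3 / b) - 1) * \<gamma> \<le> 1"
  shows "measure_pmf.prob (edge_choice n k \<delta>)
      {X. \<exists>S\<subseteq>{..<n}. real (card S) \<le> \<gamma> * real n \<and>
        b * real n \<le> real (card {e \<in> random_pairs n k. e \<inter> S \<noteq> {} \<and> X e})} \<le> exp (- real n)"
proof -
  let ?P = "measure_pmf.prob (edge_choice n k \<delta>)"
  let ?B = "\<lambda>S. {X. b * real n \<le> real (card {e \<in> random_pairs n k. e \<inter> S \<noteq> {} \<and> X e})}"
  define SS where "SS = {S. S \<subseteq> {..<n} \<and> real (card S) \<le> \<gamma> * real n}"
  have SS: "SS \<subseteq> Pow {..<n}" by (auto simp: SS_def)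
  then have fin: "finite SS" by (rule finite_subset) simp
  have single: "?P (?B S) \<le> exp (- 2 * real n)" if "S \<in> SS" for S
  proof -
    let ?T = "{e \<in> random_pairs n k. e \<inter> S \<noteq> {}}"
    have S: "S \<subseteq> {..<n}" "real (card S) \<le> \<gamma> * real n" using that by (auto simp: SS_def)
    have "card ?T \<le> card {e \<in> vertex_pairs n. e \<inter> S \<noteq> {}}"
      by (intro card_mono) (auto simp: finite_vertex_pairs)
    also have "\<dots> \<le> card S * n" by (rule card_vertex_pairs_meeting_le[OF S(1)])
    finally have "real (card ?T) \<le> real (card S * n)" by (simp only: of_nat_le_iff)
    also have "\<dots> = real (card S) * real n" by simp
    also have "\<dots> \<le> \<gamma> * real n * real n" using S by (intro mult_right_mono) auto
    finally have "\<delta> / real n * (exp (3 / b) - 1) * real (card ?T)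
        \<le> \<delta> / real n * (exp (3 / b) - 1) * (\<gamma> * real n * real n)"
      using assms by (intro mult_left_mono) auto
    also have "\<dots> = (\<delta> * (exp (3 / b) - 1) * \<gamma>) * real n" using assms by simp
    also have "\<dots> \<le> 1 * real n" using \<gamma> by (intro mult_right_mono) auto
    finally have le: "\<delta> / real n * (exp (3 / b) - 1) * real (card ?T) - 3 * real n \<le> - 2 * real n" by simp
    have "?B S = {X. 3 * real n \<le> 3 / b * real (card {e \<in> ?T. X e})}"
      using \<open>b > 0\<close> by (auto simp: field_simps)
    also have "?P \<dots> \<le> exp (\<delta> / real n * (exp (3 / b) - 1) * real (card ?T) - 3 * real n)"
      using assms by (intro prob_bernoulli_count_le) (auto simp: finite_vertex_pairs)
    also have "\<dots> \<le> exp (- 2 * real n)" using le by simp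
    finally show ?thesis .
  qed
  have "{X. \<exists>S\<subseteq>{..<n}. real (card S) \<le> \<gamma> * real n \<and>
        b * real n \<le> real (card {e \<in> random_pairs n k. e \<inter> S \<noteq> {} \<and> X e})} = (\<Union>S\<in>SS. ?B S)"
    by (auto simp: SS_def)
  also have "?P \<dots> \<le> (\<Sum>S\<in>SS. ?P (?B S))"
    using fin by (intro measure_pmf.finite_measure_subadditive_finite) auto
  also have "\<dots> \<le> (\<Sum>S\<in>SS. exp (- 2 * real n))" by (intro sum_mono single)
  also have "\<dots> = real (card SS) * exp (- 2 * real n)" by simp
  also have "\<dots> \<le> exp (real n) * exp (- 2 * real n)"
  proof (rule mult_right_mono)
    have "card SS \<le> 2 ^ n" using card_mono[OF _ SS] by (simp add: card_Pow)
    then have "real (card SS) \<le> real (2 ^ n)" by (simp only: of_nat_le_iff)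
    also have "\<dots> = 2 ^ n" by simp
    also have "\<dots> \<le> exp 1 ^ n" using exp_ge_add_one_self[of 1] by (intro power_mono) auto
    also have "\<dots> = exp (real n)" by (simp flip: exp_of_nat_mult)
    finally show "real (card SS) \<le> exp (real n)" .
  qed simp
  also have "\<dots> = exp (- real n)" by (simp flip: exp_add)
  finally show ?thesis .
qed

text \<open>
  The number of sets with a small path boundary is controlled by weighting each set \<open>S\<close> with
  \<open>exp (- L) ^ card (path_boundary n S)\<close>, which comes out of the exponential Markov bound for free.
\<close>
lemma prob_small_cut:
  assumes n: "n \<ge> 1" "\<delta> > 0" "\<delta> \<le> real n" and "L > 0" "exp (- L) \<le> 1 / 2"
    and \<gamma>: "\<gamma> > 0" "real k \<le> \<gamma> / 4 * real n"
  shows "measure_pmf.prob (edge_choice n k \<delta>)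
      {X. \<exists>S\<subseteq>{..<n}. \<gamma> * real n \<le> real (card S) \<and> \<gamma> * real n \<le> real (n - card S) \<and>
        real (card (path_boundary n S)) + real (card {e \<in> random_pairs n k. crosses S e \<and> X e}) \<le> c * real n}
      \<le> 2 * exp (real n * (exp (- L) + L * c - \<delta> * \<gamma> / 8))"
proof -
  let ?P = "measure_pmf.prob (edge_choice n k \<delta>)"
  let ?b = "\<lambda>S. card (path_boundary n S)"
  let ?B = "\<lambda>S. {X. real (?b S) + real (card {e \<in> random_pairs n k. crosses S e \<and> X e}) \<le> c * real n}"
  define SS where "SS = {S. S \<subseteq> {..<n} \<and> \<gamma> * real n \<le> real (card S) \<and> \<gamma> * real n \<le> real (n - card S)}"
  have SS: "SS \<subseteq> Pow {..<n}" by (auto simp: SS_def)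
  then have fin: "finite SS" by (rule finite_subset) simp
  define W where "W = exp (real n * (L * c - \<delta> * \<gamma> / 8))"
  have single: "?P (?B S) \<le> exp (- L) ^ ?b S * W" if "S \<in> SS" for S
  proof -
    let ?T = "{e \<in> random_pairs n k. crosses S e}"
    have S: "S \<subseteq> {..<n}" "\<gamma> * real n \<le> real (card S)" "\<gamma> * real n \<le> real (n - card S)"
      using that by (auto simp: SS_def)
    have cS: "card S \<le> n" using card_mono[OF _ S(1)] by simp
    \<comment> \<open>Both sides of the cut have at least \<open>\<gamma> * n\<close> vertices, and
      the larger has at least \<open>n / 2\<close>. Removing the at most \<open>n * k\<close> ring
      pairs costs half of this product.\<close>
    have "\<gamma> * real n * (real n / 2) \<le> real (card S) * real (n - card S)"
    proof (cases "real (card S) \<ge> real n / 2")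
      case True
      then have "(real n / 2) * (\<gamma> * real n) \<le> real (card S) * real (n - card S)"
        using S \<gamma> by (intro mult_mono) auto
      then show ?thesis by (simp add: mult.commute)
    next
      case False
      then have "real (n - card S) \<ge> real n / 2" using cS by (simp add: of_nat_diff)
      then show ?thesis using S \<gamma> by (intro mult_mono) auto
    qed
    also have "\<dots> = real (card S * (n - card S))" by simp
    also have "\<dots> \<le> real (card {e \<in> vertex_pairs n. crosses S e})"
      using card_crossing_pairs_ge[OF S(1)] by (simp only: of_nat_le_iff)
    also have "\<dots> \<le> real (card ?T + card (ring_edges n k))"
    proof -
      have "{e \<in> vertex_pairs n. crosses S e} \<subseteq> ?T \<union> ring_edges n k" by auto
      then have "card {e \<in> vertex_pairs n. crosses S e} \<le> card (?T \<union> ring_edges n k)"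
        by (intro card_mono) (auto simp: finite_vertex_pairs finite_ring_edges)
      also have "\<dots> \<le> card ?T + card (ring_edges n k)" by (rule card_Un_le)
      finally show ?thesis by (simp only: of_nat_le_iff)
    qed
    also have "\<dots> \<le> real (card ?T + n * k)"
      using card_ring_edges_le[of n k] by (simp only: of_nat_le_iff add_le_cancel_left)
    also have "\<dots> \<le> real (card ?T) + real n * (\<gamma> / 4 * real n)"
      using mult_left_mono[OF \<gamma>(2), of "real n"] by simp
    finally have cT: "\<gamma> / 4 * real n * real n \<le> real (card ?T)" by (simp add: field_simps)
    have *: "\<delta> / real n * (1 / 2) * (\<gamma> / 4 * real n * real n) \<le> \<delta> / real n * (1 - exp (- L)) * real (card ?T)"
      using assms cT by (intro mult_mono) auto
    have le: "\<delta> / real n * (exp (- L) - 1) * real (card ?T) \<le> - (real n * (\<delta> * \<gamma> / 8))"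
    proof -
      have "\<delta> / real n * (1 / 2) * (\<gamma> / 4 * real n * real n) = real n * (\<delta> * \<gamma> / 8)"
        using n by simp
      moreover have "\<delta> / real n * (exp (- L) - 1) * real (card ?T) = - (\<delta> / real n * (1 - exp (- L)) * real (card ?T))"
      proof -
        have "exp (- L) - 1 = - (1 - exp (- L))" by simp
        then show ?thesis by (simp only: mult_minus_left mult_minus_right)
      qed
      ultimately show ?thesis using * by linarith
    qed
    have "?B S \<subseteq> {X. - L * (c * real n - real (?b S)) \<le> - L * real (card {e \<in> ?T. X e})}"
    proof (intro subsetI CollectI)
      fix X assume "X \<in> ?B S"
      then have "real (?b S) + real (card {e \<in> ?T. X e}) \<le> c * real n" by simp
      from mult_left_mono[OF this, of L] \<open>L > 0\<close>
      show "- L * (c * real n - real (?b S)) \<le> - L * real (card {e \<in> ?T. X e})"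
        by (simp add: algebra_simps)
    qed
    then have "?P (?B S) \<le> ?P {X. - L * (c * real n - real (?b S)) \<le> - L * real (card {e \<in> ?T. X e})}"
      by (intro measure_pmf.finite_measure_mono) auto
    also have "\<dots> \<le> exp (\<delta> / real n * (exp (- L) - 1) * real (card ?T) - (- L * (c * real n - real (?b S))))"
      using n by (intro prob_bernoulli_count_le) (auto simp: finite_vertex_pairs)
    also have "\<dots> \<le> exp (real (?b S) * (- L) + real n * (L * c - \<delta> * \<gamma> / 8))"
    proof -
      have "- (real n * (\<delta> * \<gamma> / 8)) - (- L * (c * real n - real (?b S)))
          = real (?b S) * (- L) + real n * (L * c - \<delta> * \<gamma> / 8)"
        by (simp add: algebra_simps)
      with le show ?thesis by simp
    qed
    also have "\<dots> = exp (- L) ^ ?b S * W"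
      unfolding exp_add W_def exp_of_nat_mult ..
    finally show ?thesis .
  qed
  obtain n' where n': "n = Suc n'" using n by (cases n) auto
  have "{X. \<exists>S\<subseteq>{..<n}. \<gamma> * real n \<le> real (card S) \<and> \<gamma> * real n \<le> real (n - card S) \<and>
        real (?b S) + real (card {e \<in> random_pairs n k. crosses S e \<and> X e}) \<le> c * real n} = (\<Union>S\<in>SS. ?B S)"
    by (auto simp: SS_def)
  also have "?P \<dots> \<le> (\<Sum>S\<in>SS. ?P (?B S))"
    using fin by (intro measure_pmf.finite_measure_subadditive_finite) auto
  also have "\<dots> \<le> (\<Sum>S\<in>SS. exp (- L) ^ ?b S * W)" by (intro sum_mono single)
  \<comment> \<open>Extending to all sets gives the closed generating function; its value exceeds 2
    only by a factor \<open>exp (n * exp (- L))\<close>, small for large \<open>L\<close>.\<close>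
  also have "\<dots> \<le> (\<Sum>S\<in>Pow {..<n}. exp (- L) ^ ?b S * W)"
    by (intro sum_mono2 SS) (auto simp: W_def)
  also have "\<dots> = 2 * (1 + exp (- L)) ^ n' * W"
    unfolding sum_distrib_right[symmetric] n' sum_path_boundary ..
  also have "\<dots> \<le> 2 * exp (real n * exp (- L)) * W"
  proof -
    have "(1 + exp (- L)) ^ n' \<le> exp (exp (- L)) ^ n'"
      by (intro power_mono exp_ge_add_one_self) (simp add: add_nonneg_nonneg)
    also have "\<dots> \<le> exp (exp (- L)) ^ n" unfolding n' by (intro power_increasing) auto
    also have "\<dots> = exp (real n * exp (- L))" by (simp add: exp_of_nat_mult)
    finally show ?thesis by (intro mult_right_mono mult_left_mono) (auto simp: W_def)
  qed
  also have "\<dots> = 2 * exp (real n * (exp (- L) + L * c - \<delta> * \<gamma> / 8))"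
  proof -
    have "real n * (exp (- L) + L * c - \<delta> * \<gamma> / 8) = real n * exp (- L) + real n * (L * c - \<delta> * \<gamma> / 8)"
      by (simp add: algebra_simps)
    then show ?thesis unfolding W_def by (simp add: exp_add)
  qed
  finally show ?thesis .
qed

section \<open>Isoperimetry for a fixed choice of edges\<close>

abbreviation chosen_graph :: "nat \<Rightarrow> nat \<Rightarrow> (nat set \<Rightarrow> bool) \<Rightarrow> nat sgraph" where
  "chosen_graph n k X \<equiv> ({..<n}, ring_edges n k \<union> {e. X e})"

lemma chosen_graph_finite_graph:
  assumes "n \<ge> 2" "k \<ge> 1" and X: "\<And>e. X e \<Longrightarrow> e \<in> random_pairs n k"
  shows "finite_graph (chosen_graph n k X)"
proof
  have sub: "ring_edges n k \<union> {e. X e} \<subseteq> vertex_pairs n"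
    using X by (auto simp: ring_edges_def)
  show "finite (verts (chosen_graph n k X))" by simp
  show "verts (chosen_graph n k X) \<noteq> {}" using assms(1) by (auto simp: lessThan_empty_iff)
  show "e \<subseteq> verts (chosen_graph n k X) \<and> card e = 2" if "e \<in> edges (chosen_graph n k X)" for e
    using that sub by (auto simp: vertex_pairs_def)
  show "degree (chosen_graph n k X) v > 0" if v: "v \<in> verts (chosen_graph n k X)" for v
  proof -
    obtain e where e: "e \<in> ring_edges n k" "v \<in> e"
      using ex_ring_edge[of v n k] v assms by auto
    have "finite {e \<in> edges (chosen_graph n k X). v \<in> e}"
      by (rule finite_subset[OF _ finite_vertex_pairs[of n]]) (use sub in auto)
    moreover have "{e \<in> edges (chosen_graph n k X). v \<in> e} \<noteq> {}" using e by auto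
    ultimately show ?thesis unfolding degree_def by (simp add: card_gt_0_iff)
  qed
qed

text \<open>Ring edges give each vertex degree at most \<open>2 * k\<close>; a random edge is
  counted at most once for each of its two ends.\<close>

lemma sum_degree_chosen_graph_le:
  assumes S: "S \<subseteq> {..<n}" and X: "\<And>e. X e \<Longrightarrow> e \<in> random_pairs n k"
  shows "(\<Sum>x\<in>S. degree (chosen_graph n k X) x)
    \<le> 2 * k * card S + 2 * card {e \<in> random_pairs n k. e \<inter> S \<noteq> {} \<and> X e}"
proof -
  define R where "R = {e \<in> random_pairs n k. e \<inter> S \<noteq> {} \<and> X e}"
  have fS: "finite S" using finite_subset[OF S] by simp
  have fR: "finite R" unfolding R_def by (simp add: finite_vertex_pairs)
  have "degree (chosen_graph n k X) x \<le> 2 * k + card {e \<in> R. x \<in> e}" if "x \<in> S" for x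
  proof -
    have "{e \<in> edges (chosen_graph n k X). x \<in> e} \<subseteq> {e \<in> ring_edges n k. x \<in> e} \<union> {e \<in> R. x \<in> e}"
      using X that by (auto simp: R_def)
    then have "degree (chosen_graph n k X) x \<le> card ({e \<in> ring_edges n k. x \<in> e} \<union> {e \<in> R. x \<in> e})"
      unfolding degree_def using fR by (intro card_mono) (auto simp: finite_ring_edges)
    also have "\<dots> \<le> card {e \<in> ring_edges n k. x \<in> e} + card {e \<in> R. x \<in> e}" by (rule card_Un_le)
    finally show ?thesis using ring_degree_le[of n k x] by linarith
  qed
  then have "(\<Sum>x\<in>S. degree (chosen_graph n k X) x) \<le> (\<Sum>x\<in>S. 2 * k + card {e \<in> R. x \<in> e})"
    by (intro sum_mono)
  also have "\<dots> = 2 * k * card S + (\<Sum>x\<in>S. card {e \<in> R. x \<in> e})"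
    by (simp add: sum.distrib)
  also have "(\<Sum>x\<in>S. card {e \<in> R. x \<in> e}) = (\<Sum>e\<in>R. card {x \<in> S. x \<in> e})"
    by (rule sum_multicount_gen[OF fS fR]) simp
  also have "\<dots> \<le> (\<Sum>e\<in>R. 2)"
  proof (intro sum_mono)
    fix e assume "e \<in> R"
    then have e: "e \<subseteq> {..<n}" "card e = 2" by (auto simp: R_def vertex_pairs_def)
    then have "finite e" using finite_subset by blast
    then have "card {x \<in> S. x \<in> e} \<le> card e" by (intro card_mono) auto
    then show "card {x \<in> S. x \<in> e} \<le> 2" using e by simp
  qed
  finally show ?thesis by (simp add: R_def)
qed

lemma cut_chosen_graph_ge:
  assumes S: "S \<subseteq> {..<n}" and k: "k \<ge> 1" and X: "\<And>e. X e \<Longrightarrow> e \<in> random_pairs n k"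
  shows "card (path_boundary n S) + card {e \<in> random_pairs n k. crosses S e \<and> X e}
    \<le> card {(x, y) \<in> S \<times> ({..<n} - S). {x, y} \<in> edges (chosen_graph n k X)}"
proof -
  let ?P = "{(x, y) \<in> S \<times> ({..<n} - S). {x, y} \<in> edges (chosen_graph n k X)}"
  let ?R = "{e \<in> ring_edges n k. crosses S e}" and ?T = "{e \<in> random_pairs n k. crosses S e \<and> X e}"
  have sub: "?R \<union> ?T \<subseteq> (\<lambda>(x, y). {x, y}) ` ?P"
  proof
    fix e assume e: "e \<in> ?R \<union> ?T"
    then have "e \<in> vertex_pairs n" "crosses S e" "e \<in> edges (chosen_graph n k X)"
      by (auto simp: ring_edges_def)
    then obtain x y where "e = {x, y}" "x \<in> S" "y \<in> {..<n} - S" "e \<in> edges (chosen_graph n k X)"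
    proof -
      obtain a b where ab: "e = {a, b}" "a < n" "b < n"
        using \<open>e \<in> vertex_pairs n\<close> by (rule vertex_pairs_E)
      then consider "a \<in> S \<and> b \<notin> S" | "b \<in> S \<and> a \<notin> S"
        using \<open>crosses S e\<close> by (auto simp: crosses_def)
      then show ?thesis
      proof cases
        case 1
        then show ?thesis using that[of a b] ab \<open>e \<in> edges (chosen_graph n k X)\<close> by simp
      next
        case 2
        then show ?thesis
          using that[of b a] ab \<open>e \<in> edges (chosen_graph n k X)\<close> by (simp add: insert_commute)
      qed
    qed
    then show "e \<in> (\<lambda>(x, y). {x, y}) ` ?P" by (auto simp: image_iff)
  qed
  have "finite ?P"
    by (rule finite_subset[of _ "S \<times> {..<n}"]) (use finite_subset[OF S] in auto)
  then have "card (?R \<union> ?T) \<le> card ?P" using sub by (rule surj_card_le)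
  moreover have "card (?R \<union> ?T) = card ?R + card ?T"
    by (rule card_Un_disjoint) (auto simp: finite_ring_edges finite_vertex_pairs)
  ultimately show ?thesis using card_path_boundary_le[OF k, of n S] by linarith
qed

text \<open>If one side has mass below \<open>\<eta>\<close>, so has the product. Otherwise both
  sides are large by \<open>light\<close>, and \<open>expand\<close> gives more than
  \<open>c * n\<close> cut edges; with \<open>m \<le> K * n\<close> the quotient on the right is
  then at least 1, hence the constant \<open>c / K\<close>.\<close>

lemma chosen_graph_isoperimetry:
  fixes K K1 \<eta> \<gamma> c :: real
  assumes n: "n \<ge> 2" and k: "k \<ge> 1" and X: "\<And>e. X e \<Longrightarrow> e \<in> random_pairs n k"
    and \<eta>: "\<eta> > 0" and \<gamma>: "4 * real k * \<gamma> \<le> \<eta>" and c: "c > 0" and K: "K > 0"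
    and few: "real (card (edges (chosen_graph n k X))) \<le> K * real n"
    and light: "\<And>S. S \<subseteq> {..<n} \<Longrightarrow> real (card S) \<le> \<gamma> * real n \<Longrightarrow>
      real (card {e \<in> random_pairs n k. e \<inter> S \<noteq> {} \<and> X e}) < \<eta> / 4 * real n"
    and expand: "\<And>S. S \<subseteq> {..<n} \<Longrightarrow> \<gamma> * real n \<le> real (card S) \<Longrightarrow> \<gamma> * real n \<le> real (n - card S) \<Longrightarrow>
      c * real n < real (card (path_boundary n S)) + real (card {e \<in> random_pairs n k. crosses S e \<and> X e})"
    and S: "S \<subseteq> {..<n}"
  shows "sum (stationary (chosen_graph n k X)) S * sum (stationary (chosen_graph n k X)) ({..<n} - S)
    \<le> \<eta> + (\<Sum>x\<in>S. \<Sum>y\<in>{..<n} - S. finite_graph.adj (chosen_graph n k X) x y)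
      / (c / K * real (card (edges (chosen_graph n k X))))"
proof -
  let ?H = "chosen_graph n k X"
  interpret finite_graph ?H by (rule chosen_graph_finite_graph[OF n k X])
  let ?p = "stationary ?H"
  have p0: "?p x \<ge> 0" for x by (simp add: stationary_def)
  have le1: "sum ?p U \<le> 1" if "U \<subseteq> {..<n}" for U
    using sum_mono2[of "{..<n}" U ?p] that p0 sum_stationary by simp
  have q0: "sum ?p U \<ge> 0" for U by (intro sum_nonneg p0)
  have A0: "(\<Sum>x\<in>S. \<Sum>y\<in>{..<n} - S. adj x y) \<ge> 0" by (intro sum_nonneg adj_nonneg)
  \<comment> \<open>All degrees are positive, so \<open>n \<le> 2 * m\<close> and mass
    \<open>\<eta>\<close> needs degree sum at least \<open>\<eta> * n\<close>. A set of at most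
    \<open>\<gamma> * n\<close> vertices gets at most half of that from the ring and less than half
    from random edges.\<close>
  have big: "\<gamma> * real n < real (card U)" if U: "U \<subseteq> {..<n}" and pU: "sum ?p U \<ge> \<eta>" for U
  proof (rule ccontr)
    assume "\<not> ?thesis"
    then have small: "real (card U) \<le> \<gamma> * real n" by simp
    have "real n = (\<Sum>x<n. 1)" by simp
    also have "\<dots> \<le> (\<Sum>x<n. real (degree ?H x))"
      using degree_pos by (intro sum_mono) (simp add: Suc_leI)
    also have "\<dots> = 2 * m" using sum_degree by simp
    finally have nm: "real n \<le> 2 * m" .
    have "\<eta> * real n \<le> \<eta> * (2 * m)" using nm \<eta> by (intro mult_left_mono) auto
    also have "\<dots> \<le> sum ?p U * (2 * m)" using pU by (intro mult_right_mono) auto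
    also have "\<dots> = (\<Sum>x\<in>U. real (degree ?H x))"
      unfolding sum_distrib_right using card_edges_pos by (intro sum.cong refl) (simp add: stationary_def)
    also have "\<dots> = real (\<Sum>x\<in>U. degree ?H x)" by simp
    also have "\<dots> \<le> real (2 * k * card U + 2 * card {e \<in> random_pairs n k. e \<inter> U \<noteq> {} \<and> X e})"
      using sum_degree_chosen_graph_le[OF U X] by (simp only: of_nat_le_iff)
    also have "\<dots> = 2 * real k * real (card U) + 2 * real (card {e \<in> random_pairs n k. e \<inter> U \<noteq> {} \<and> X e})"
      by simp
    also have "\<dots> < 2 * real k * (\<gamma> * real n) + 2 * (\<eta> / 4 * real n)"
      using light[OF U small] mult_left_mono[OF small, of "2 * real k"] by linarith
    also have "\<dots> = (2 * real k * \<gamma> + \<eta> / 2) * real n" by (simp add: algebra_simps)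
    also have "\<dots> \<le> \<eta> * real n" using \<gamma> by (intro mult_right_mono) auto
    finally show False by simp
  qed
  have cm: "c / K * m > 0" using c K card_edges_pos by simp
  show ?thesis
  proof (cases "sum ?p S \<ge> \<eta> \<and> sum ?p ({..<n} - S) \<ge> \<eta>")
    case True
    have cS: "card ({..<n} - S) = n - card S"
      using S by (simp add: card_Diff_subset finite_subset[OF S])
    have "c * real n < real (card (path_boundary n S)) + real (card {e \<in> random_pairs n k. crosses S e \<and> X e})"
      using True big[OF S] big[of "{..<n} - S"] cS by (intro expand S) auto
    also have "\<dots> = real (card (path_boundary n S) + card {e \<in> random_pairs n k. crosses S e \<and> X e})" by simp
    also have "\<dots> \<le> real (card {(x, y) \<in> S \<times> ({..<n} - S). {x, y} \<in> edges ?H})"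
      using cut_chosen_graph_ge[OF S k X] by (simp only: of_nat_le_iff)
    also have "\<dots> = (\<Sum>(x, y)\<in>S \<times> ({..<n} - S). adj x y)"
    proof -
      have "(\<Sum>(x, y)\<in>S \<times> ({..<n} - S). adj x y)
          = (\<Sum>z\<in>S \<times> ({..<n} - S). if {fst z, snd z} \<in> edges ?H then 1 else 0)"
        by (intro sum.cong refl) (auto simp: adj_def)
      also have "\<dots> = real (card {z \<in> S \<times> ({..<n} - S). {fst z, snd z} \<in> edges ?H})"
        using finite_subset[OF S] by (simp flip: sum.inter_filter)
      also have "{z \<in> S \<times> ({..<n} - S). {fst z, snd z} \<in> edges ?H}
          = {(x, y) \<in> S \<times> ({..<n} - S). {x, y} \<in> edges ?H}" by auto
      finally show ?thesis by (rule sym)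
    qed
    also have "\<dots> = (\<Sum>x\<in>S. \<Sum>y\<in>{..<n} - S. adj x y)" by (rule sum.cartesian_product[symmetric])
    finally have cut: "c * real n < \<dots>" .
    have "c / K * m \<le> c / K * (K * real n)" using few c K by (intro mult_left_mono) auto
    also have "\<dots> = c * real n" using K by simp
    finally have "1 \<le> (\<Sum>x\<in>S. \<Sum>y\<in>{..<n} - S. adj x y) / (c / K * m)"
      unfolding le_divide_eq_1_pos[OF cm] using cut by linarith
    moreover have "sum ?p S * sum ?p ({..<n} - S) \<le> 1"
      using le1[OF S] le1[of "{..<n} - S"] q0 by (intro mult_le_one) auto
    ultimately show ?thesis using \<eta> by linarith
  next
    case False
    then have "sum ?p S * sum ?p ({..<n} - S) \<le> \<eta>"
    proof (cases "sum ?p S \<ge> \<eta>")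
      case True
      then have "sum ?p ({..<n} - S) \<le> \<eta>" using False by simp
      then have "sum ?p S * sum ?p ({..<n} - S) \<le> 1 * \<eta>"
        using le1[OF S] q0 by (intro mult_mono) auto
      then show ?thesis by simp
    next
      case F: False
      then have "sum ?p S * sum ?p ({..<n} - S) \<le> \<eta> * 1"
        using le1[of "{..<n} - S"] q0 \<eta> by (intro mult_mono) auto
      then show ?thesis by simp
    qed
    moreover have "(\<Sum>x\<in>S. \<Sum>y\<in>{..<n} - S. adj x y) / (c / K * m) \<ge> 0"
      using A0 cm by (intro divide_nonneg_pos)
    ultimately show ?thesis by linarith
  qed
qed

theorem corollary1p8:
  fixes k :: nat and \<epsilon> \<delta> :: real
  assumes "k \<ge> 1" and "\<epsilon> > 0" and "\<delta> > 0"
  shows "\<exists>C::real. C > 0 \<and>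
    (\<lambda>n. measure_pmf.prob (newman_watts n k \<delta>)
           {H. ereal_of_enat (avg_mixing_time H \<epsilon>) \<le> ereal (C * ln (real n))}) \<longlonglongrightarrow> 1"
proof -
  \<comment> \<open>At most \<open>k * n\<close> ring edges, plus the threshold of
    \<open>prob_many_edges\<close>.\<close>
  define K where "K = real k + (2 * \<delta> + 1)"
  have K: "K > 0" using assms by (simp add: K_def)
  define \<omega> where "\<omega> = \<epsilon> / (2 * K)"
  have \<omega>: "\<omega> > 0" using assms K by (simp add: \<omega>_def)
  define M where "M = 10 / \<omega>"
  have M: "M > 0" using \<omega> by (simp add: M_def)
  define \<eta> where "\<eta> = \<omega>\<^sup>2 / (64 * M\<^sup>2)"
  have \<eta>: "\<eta> > 0" using \<omega> M by (simp add: \<eta>_def)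
  define D where "D = \<delta> * (exp (3 / (\<eta> / 4)) - 1)"
  have D: "D > 0" using assms \<eta> by (simp add: D_def)
  \<comment> \<open>The first bound keeps the ring's share of a small set below half of
    \<open>\<eta>\<close>; the second is the moment condition of \<open>prob_heavy_small_set\<close>
    for \<open>b = \<eta> / 4\<close>.\<close>
  define \<gamma> where "\<gamma> = min (\<eta> / (4 * real k)) (1 / D)"
  have \<gamma>: "\<gamma> > 0" using \<eta> D assms by (simp add: \<gamma>_def)
  have \<gamma>1: "4 * real k * \<gamma> \<le> \<eta>"
  proof -
    have "\<gamma> \<le> \<eta> / (4 * real k)" by (simp add: \<gamma>_def)
    then show ?thesis using assms by (simp add: pos_le_divide_eq mult.commute)
  qed
  have \<gamma>2: "D * \<gamma> \<le> 1"
  proof -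
    have "\<gamma> \<le> 1 / D" by (simp add: \<gamma>_def)
    then show ?thesis using D by (simp add: pos_le_divide_eq mult.commute)
  qed
  define \<beta> where "\<beta> = \<delta> * \<gamma> / 8"
  have \<beta>: "\<beta> > 0" using assms \<gamma> by (simp add: \<beta>_def)
  \<comment> \<open>The exponent per vertex in \<open>prob_small_cut\<close> is
    \<open>exp (- L) + L * c - \<beta>\<close>. Choosing \<open>L\<close> and then \<open>c\<close>
    so that the first two terms are at most \<open>\<beta> / 4\<close> each leaves
    \<open>- \<beta> / 2\<close>. The cap \<open>1 / 2\<close> is required there and keeps
    \<open>L\<close> positive.\<close>
  define q where "q = min (1 / 2) (\<beta> / 4)"
  have q: "q > 0" "q \<le> 1 / 2" "q \<le> \<beta> / 4" using \<beta> by (auto simp: q_def)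
  define L where "L = - ln q"
  have L: "L > 0" "exp (- L) = q" using q ln_less_zero[of q] by (auto simp: L_def)
  define c where "c = \<beta> / (4 * L)"
  have c: "c > 0" "L * c = \<beta> / 4" using \<beta> L by (auto simp: c_def)
  define \<alpha> where "\<alpha> = 32 * M / (c / K * \<omega>\<^sup>2)"
  define C where "C = 256 * M * \<alpha> / (c / K * \<omega>\<^sup>2)"
  have C: "C > 0" using \<omega> M c K by (simp add: C_def \<alpha>_def)
  define f where "f n = measure_pmf.prob (newman_watts n k \<delta>)
      {H. ereal_of_enat (avg_mixing_time H \<epsilon>) \<le> ereal (C * ln (real n))}" for n
  have lower: "1 - (2 * exp (- real n) + 2 * exp (- (\<beta> / 2) * real n)) \<le> f n"
    if n: "n \<ge> 2" "\<delta> \<le> real n" "real k \<le> \<gamma> / 4 * real n" for n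
  proof -
    let ?M = "edge_choice n k \<delta>" and ?P = "measure_pmf.prob (edge_choice n k \<delta>)"
    define B1 where "B1 = {X. (2 * \<delta> + 1) * real n \<le> real (card {e \<in> random_pairs n k. X e})}"
    define B2 where "B2 = {X. \<exists>S\<subseteq>{..<n}. real (card S) \<le> \<gamma> * real n \<and>
        \<eta> / 4 * real n \<le> real (card {e \<in> random_pairs n k. e \<inter> S \<noteq> {} \<and> X e})}"
    define B3 where "B3 = {X. \<exists>S\<subseteq>{..<n}. \<gamma> * real n \<le> real (card S) \<and> \<gamma> * real n \<le> real (n - card S) \<and>
        real (card (path_boundary n S)) + real (card {e \<in> random_pairs n k. crosses S e \<and> X e}) \<le> c * real n}"
    define G where "G = {X. ereal_of_enat (avg_mixing_time (chosen_graph n k X) \<epsilon>) \<le> ereal (C * ln (real n))}"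
    have n1: "n \<ge> 1" using n by simp
    have fG: "f n = ?P G"
      unfolding f_def newman_watts_def G_def measure_map_pmf by (simp add: vimage_def)
    have P1: "?P B1 \<le> exp (- real n)"
      unfolding B1_def by (rule prob_many_edges[OF n1 assms(3) n(2)])
    have P2: "?P B2 \<le> exp (- real n)"
      unfolding B2_def using \<eta> \<gamma>2 by (intro prob_heavy_small_set[OF n1 assms(3) n(2)]) (auto simp: D_def)
    have "?P B3 \<le> 2 * exp (real n * (exp (- L) + L * c - \<delta> * \<gamma> / 8))"
      unfolding B3_def using L q by (intro prob_small_cut[OF n1 assms(3) n(2) _ _ \<gamma> n(3)]) auto
    also have "\<dots> \<le> 2 * exp (- (\<beta> / 2) * real n)"
    proof -
      have "real n * (exp (- L) + L * c - \<delta> * \<gamma> / 8) \<le> real n * (- (\<beta> / 2))"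
        using q L c by (intro mult_left_mono) (auto simp: \<beta>_def)
      then show ?thesis by (simp add: mult.commute)
    qed
    finally have P3: "?P B3 \<le> 2 * exp (- (\<beta> / 2) * real n)" .
    have good: "X \<in> G" if XM: "X \<in> set_pmf ?M" and nB: "X \<notin> B1" "X \<notin> B2" "X \<notin> B3" for X
    proof -
      have fin: "finite (random_pairs n k)" by (simp add: finite_vertex_pairs)
      \<comment> \<open>In the support of the product measure, pairs outside the index set take the
        default value \<open>False\<close>.\<close>
      have X: "e \<in> random_pairs n k" if "X e" for e
      proof (rule ccontr)
        assume "e \<notin> random_pairs n k"
        with subsetD[OF set_Pi_pmf_subset[OF fin] XM] have "\<not> X e" by simp
        then show False using that by simp
      qed
      let ?H = "chosen_graph n k X"
      interpret finite_graph ?H by (rule chosen_graph_finite_graph[OF n(1) assms(1) X])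
      have few: "real (card (edges ?H)) \<le> K * real n"
      proof -
        have eq: "{e. X e} = {e \<in> random_pairs n k. X e}" using X by auto
        have "card (edges ?H) \<le> card (ring_edges n k) + card {e. X e}"
          by (simp add: card_Un_le)
        also have "\<dots> \<le> n * k + card {e \<in> random_pairs n k. X e}"
          unfolding eq using card_ring_edges_le by (intro add_mono) auto
        finally have "real (card (edges ?H)) \<le> real (n * k + card {e \<in> random_pairs n k. X e})"
          by (simp only: of_nat_le_iff)
        also have "\<dots> \<le> real n * real k + (2 * \<delta> + 1) * real n"
          using nB(1) by (simp add: B1_def)
        finally show ?thesis by (simp add: K_def algebra_simps)
      qed
      have "ereal_of_enat (avg_mixing_time ?H \<epsilon>) \<le> ereal (C * ln (real (card (verts ?H))))"
      proof (rule avg_mixing_time_le[OF assms(2) K _ _ _ _ \<omega>_def M_def \<eta>_def \<alpha>_def C_def])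
        show "c / K > 0" using c K by simp
        show "2 \<le> card (verts ?H)" using n by simp
        show "real (card (edges ?H)) \<le> K * real (card (verts ?H))" using few by simp
        fix S assume "S \<subseteq> verts ?H"
        then have S: "S \<subseteq> {..<n}" by simp
        have light: "real (card {e \<in> random_pairs n k. e \<inter> S \<noteq> {} \<and> X e}) < \<eta> / 4 * real n"
          if "S \<subseteq> {..<n}" "real (card S) \<le> \<gamma> * real n" for S
          using nB(2) that unfolding B2_def by (auto simp: not_le)
        have expand: "c * real n < real (card (path_boundary n S)) + real (card {e \<in> random_pairs n k. crosses S e \<and> X e})"
          if "S \<subseteq> {..<n}" "\<gamma> * real n \<le> real (card S)" "\<gamma> * real n \<le> real (n - card S)" for S
          using nB(3) that unfolding B3_def by (auto simp: not_le)
        show "sum (stationary ?H) S * sum (stationary ?H) (verts ?H - S)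
            \<le> \<eta> + (\<Sum>x\<in>S. \<Sum>y\<in>verts ?H - S. adj x y) / (c / K * real (card (edges ?H)))"
          using chosen_graph_isoperimetry[OF n(1) assms(1) X \<eta> \<gamma>1 c(1) K few light expand S] by simp
      qed
      then show ?thesis by (simp add: G_def)
    qed
    \<comment> \<open>Outside the bad events \<open>G\<close> is known only on the support, so the
      inclusion is used almost everywhere.\<close>
    have "1 = ?P UNIV" by simp
    also have "\<dots> \<le> ?P (G \<union> (B1 \<union> (B2 \<union> B3)))"
    proof (rule measure_pmf.finite_measure_mono_AE)
      show "AE X in ?M. X \<in> UNIV \<longrightarrow> X \<in> G \<union> (B1 \<union> (B2 \<union> B3))"
        unfolding AE_measure_pmf_iff using good by blast
    qed simp
    also have "\<dots> \<le> ?P G + ?P (B1 \<union> (B2 \<union> B3))" by (rule measure_Un_le) auto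
    also have "?P (B1 \<union> (B2 \<union> B3)) \<le> ?P B1 + ?P (B2 \<union> B3)" by (rule measure_Un_le) auto
    also have "?P (B2 \<union> B3) \<le> ?P B2 + ?P B3" by (rule measure_Un_le) auto
    finally show ?thesis using P1 P2 P3 fG by linarith
  qed
  have "f \<longlonglongrightarrow> 1"
  proof (rule tendsto_sandwich)
    have N: "\<forall>\<^sub>F n in sequentially. a \<le> real n" for a
      using filterlim_real_sequentially by (simp add: filterlim_at_top)
    show "\<forall>\<^sub>F n in sequentially. 1 - (2 * exp (- real n) + 2 * exp (- (\<beta> / 2) * real n)) \<le> f n"
      using N[of 2] N[of \<delta>] N[of "real k / (\<gamma> / 4)"]
    proof eventually_elim
      case (elim n)
      then show ?case using \<gamma> by (intro lower) (auto simp: field_simps)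
    qed
    show "\<forall>\<^sub>F n in sequentially. f n \<le> 1"
      unfolding f_def by (intro always_eventually allI measure_pmf.prob_le_1)
    have "(\<lambda>n. exp (- a * real n)) \<longlonglongrightarrow> 0" if "a > 0" for a :: real
    proof -
      have "filterlim (\<lambda>n. - a * real n) at_bot sequentially"
        using that filterlim_real_sequentially
        by (intro filterlim_tendsto_neg_mult_at_bot[OF tendsto_const]) auto
      then show ?thesis by (rule filterlim_compose[OF exp_at_bot])
    qed
    from this[of 1] this[of "\<beta> / 2"]
    have "(\<lambda>n. exp (- real n)) \<longlonglongrightarrow> 0" "(\<lambda>n. exp (- (\<beta> / 2) * real n)) \<longlonglongrightarrow> 0" using \<beta> by simp_all
    then have "(\<lambda>n. 1 - (2 * exp (- real n) + 2 * exp (- (\<beta> / 2) * real n))) \<longlonglongrightarrow> 1 - (2 * 0 + 2 * 0)"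
      by (intro tendsto_intros)
    then show "(\<lambda>n. 1 - (2 * exp (- real n) + 2 * exp (- (\<beta> / 2) * real n))) \<longlonglongrightarrow> 1" by simp
  qed simp
  then show ?thesis using C unfolding f_def by blast
qed

end
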